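(* Let $M$ be an almost-CR manifold, $\Omega\subset M$ open and $p_0\in\Omega$. If $\rho_1,\rho_2\in C^\infty(\Omega)$ are real valued functions which agree to the second order at $p_0$, then $$dd^c\rho_1(\tau_0)=dd^c\rho_2(\tau_0),\qquad\forall\tau_0\in[\ker\mathcal{L}]_{p_0}.$$
   Context: An almost-CR manifold is a smooth real manifold $M$ with a smooth complex subbundle $T^{0,1}M\subset\mathbb{C}TM$ of constant rank such that $T^{0,1}M\cap\overline{T^{0,1}M}=0$; no formal integrability is required. $\mathcal{Z}$ is the sheaf of smooth sections of $T^{0,1}M$, $H_pM=\{\mathrm{Re}\,Z\mid Z\in T^{0,1}_pM\}$, $\pi_M:TM\to TM/HM$ the projection. $H^{1,1}_pM$ is the convex hull of $\{Z_p\otimes\bar Z_p\mid Z_p\in T^{0,1}_pM\}$. The vector valued Levi form is the linear extension $\mathcal{L}:H^{1,1}M\to TM/HM$ of $Z_p\otimes\bar Z_p\mapsto-\pi_M(i[Z,\bar Z]_p)$, $Z\in\mathcal{Z}$, and $[\ker\mathcal{L}]_p=\{\tau\in H^{1,1}_pM\mid\tau\neq0,\ \mathcal{L}(\tau)=0\}$. Definition of $dd^c$: for a smooth real function $\rho$ near $p_0$, choose a smooth real $1$-form $\xi$ near $p_0$ such that $d\rho+i\xi$ vanishes on $T^{0,1}M$ (such $\xi$ exists, and is unique up to sections of the annihilator of $HM$). For $\tau_0=\sum_jZ_j\otimes\bar Z_j\in[\ker\mathcal{L}]_{p_0}$ set $dd^c\rho_{p_0}(\tau_0)=\tfrac{i}{2}d\xi(\tau_0)=\tfrac{i}{2}\sum_jd\xi(Z_j,\bar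 Z_j)$, which does not depend on the choice of $\xi$. Convention: $d\xi(X,Y)=X\xi(Y)-Y\xi(X)-\xi([X,Y])$. *)

theory Defs
  imports "HOL-Analysis.Analysis" "HOL-Library.Function_Algebras"
begin

text \<open>Pointwise vector space structures on functions. Tangent vectors and tensors are represented
  below by complex valued functions, so these provide sums, convex hulls and complex spans.\<close>

instantiation "fun" :: (type, real_vector) real_vector
begin

definition scaleR_fun_def: "scaleR r f = (\<lambda>x. r *\<^sub>R f x)"

instance
  by standard (auto simp: scaleR_fun_def fun_eq_iff algebra_simps)

end

definition cscale :: "complex \<Rightarrow> ('x \<Rightarrow> complex) \<Rightarrow> ('x \<Rightarrow> complex)" (infixr \<open>*\<^sub>c\<close> 75) where
  "c *\<^sub>c v = (\<lambda>x. c * v x)"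

global_interpretation cvs: vector_space "cscale :: complex \<Rightarrow> ('x \<Rightarrow> complex) \<Rightarrow> ('x \<Rightarrow> complex)"
  defines cspan = cvs.span and cindependent = "\<lambda>S. \<not> cvs.dependent S"
  by unfold_locales (auto simp: cscale_def fun_eq_iff algebra_simps)


section \<open>Smooth manifolds\<close>

text \<open>\<open>C\<^sup>k\<close> maps on an open subset of a Euclidean space.\<close>

primrec Ck_on :: "nat \<Rightarrow> 'e::euclidean_space set \<Rightarrow> ('e \<Rightarrow> 'b::real_normed_vector) \<Rightarrow> bool" where
  "Ck_on 0 S f \<longleftrightarrow> continuous_on S f"
| "Ck_on (Suc k) S f \<longleftrightarrow> (\<forall>x\<in>S. f differentiable (at x)) \<and>
     (\<forall>v. Ck_on k S (\<lambda>x. frechet_derivative f (at x) v))"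

definition smooth_on :: "'e::euclidean_space set \<Rightarrow> ('e \<Rightarrow> 'b::real_normed_vector) \<Rightarrow> bool" where
  "smooth_on S f \<longleftrightarrow> (\<forall>k. Ck_on k S f)"

record ('a, 'e) mfd =
  mtop :: "'a topology"
  atlas :: "('a set \<times> ('a \<Rightarrow> 'e)) set"

definition smooth_manifold :: "('a, 'e::euclidean_space) mfd \<Rightarrow> bool" where
  "smooth_manifold M \<longleftrightarrow>
     Hausdorff_space (mtop M) \<and> second_countable (mtop M) \<and>
     (\<Union>(V, \<phi>)\<in>atlas M. V) = topspace (mtop M) \<and>
     (\<forall>(V, \<phi>)\<in>atlas M. openin (mtop M) V \<and> open (\<phi> ` V) \<and>
        homeomorphic_map (subtopology (mtop M) V) (top_of_set (\<phi> ` V)) \<phi>) \<and>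
     (\<forall>(V, \<phi>)\<in>atlas M. \<forall>(W, \<psi>)\<in>atlas M. smooth_on (\<phi> ` (V \<inter> W)) (\<psi> \<circ> inv_into V \<phi>))"

definition smooth_fun ::
  "('a, 'e::euclidean_space) mfd \<Rightarrow> 'a set \<Rightarrow> ('a \<Rightarrow> 'b::real_normed_vector) \<Rightarrow> bool" where
  "smooth_fun M U f \<longleftrightarrow> openin (mtop M) U \<and>
     (\<forall>(V, \<phi>)\<in>atlas M. smooth_on (\<phi> ` (U \<inter> V)) (f \<circ> inv_into V \<phi>))"

definition smooth_at ::
  "('a, 'e::euclidean_space) mfd \<Rightarrow> 'a \<Rightarrow> ('a \<Rightarrow> 'b::real_normed_vector) \<Rightarrow> bool" where
  "smooth_at M p f \<longleftrightarrow> (\<exists>U. p \<in> U \<and> smooth_fun M U f)"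

text \<open>Same 2-jet at \<open>p\<close>: in local coordinates near \<open>p\<close> the values, the first and the second
  derivatives coincide at \<open>p\<close>.\<close>

definition agree_to_second_order ::
  "('a, 'e::euclidean_space) mfd \<Rightarrow> 'a \<Rightarrow> ('a \<Rightarrow> real) \<Rightarrow> ('a \<Rightarrow> real) \<Rightarrow> bool" where
  "agree_to_second_order M p f g \<longleftrightarrow>
     (\<exists>(V, \<phi>)\<in>atlas M. p \<in> V \<and>
       (let F = f \<circ> inv_into V \<phi>; G = g \<circ> inv_into V \<phi>; x = \<phi> p in
          F x = G x \<and>
          frechet_derivative F (at x) = frechet_derivative G (at x) \<and>
          (\<forall>v. frechet_derivative (\<lambda>y. frechet_derivative F (at y) v) (at x) =
               frechet_derivative (\<lambda>y. frechet_derivative G (at y) v) (at x))))"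


section \<open>Complexified tangent vectors, vector fields and forms\<close>

type_synonym 'a ctvec = "('a \<Rightarrow> complex) \<Rightarrow> complex"

text \<open>The fibre of \<open>\<complex>TM\<close> at \<open>p\<close>: complex derivations at \<open>p\<close> of the complex valued functions that are
  smooth near \<open>p\<close>. By the Leibniz rule such a derivation depends only on the germ of its argument
  (multiply by the indicator function of a neighbourhood). The value \<open>0\<close> on all other functions is
  a convention that makes vectors equal when they agree as derivations.\<close>

definition ctangent :: "('a, 'e::euclidean_space) mfd \<Rightarrow> 'a \<Rightarrow> 'a ctvec set" where
  "ctangent M p = {v.
     (\<forall>f. \<not> smooth_at M p f \<longrightarrow> v f = 0) \<and>
     (\<forall>f g. smooth_at M p f \<longrightarrow> smooth_at M p g \<longrightarrow> v (\<lambda>x. f x + g x) = v f + v g) \<and>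
     (\<forall>c f. smooth_at M p f \<longrightarrow> v (\<lambda>x. c * f x) = c * v f) \<and>
     (\<forall>f g. smooth_at M p f \<longrightarrow> smooth_at M p g \<longrightarrow> v (\<lambda>x. f x * g x) = f p * v g + g p * v f)}"

definition conj_vec :: "'a ctvec \<Rightarrow> 'a ctvec" where
  "conj_vec v = (\<lambda>f. cnj (v (\<lambda>x. cnj (f x))))"

text \<open>\<open>TM\<close> sits in \<open>\<complex>TM\<close> as the self-conjugate vectors, i.e. those mapping real functions to
  real numbers.\<close>

definition tangent :: "('a, 'e::euclidean_space) mfd \<Rightarrow> 'a \<Rightarrow> 'a ctvec set" where
  "tangent M p = {v \<in> ctangent M p. conj_vec v = v}"

definition Re_vec :: "'a ctvec \<Rightarrow> 'a ctvec" where
  "Re_vec v = (1/2) *\<^sub>c (v + conj_vec v)"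

definition smooth_field ::
  "('a, 'e::euclidean_space) mfd \<Rightarrow> 'a set \<Rightarrow> ('a \<Rightarrow> 'a ctvec) \<Rightarrow> bool" where
  "smooth_field M U X \<longleftrightarrow> openin (mtop M) U \<and>
     (\<forall>p\<in>U. X p \<in> ctangent M p) \<and>
     (\<forall>V f. V \<subseteq> U \<longrightarrow> smooth_fun M V f \<longrightarrow> smooth_fun M V (\<lambda>q. X q f))"

definition lie_bracket ::
  "('a, 'e::euclidean_space) mfd \<Rightarrow> ('a \<Rightarrow> 'a ctvec) \<Rightarrow> ('a \<Rightarrow> 'a ctvec) \<Rightarrow> 'a \<Rightarrow> 'a ctvec" where
  "lie_bracket M X Y p = (\<lambda>f. if smooth_at M p f
     then X p (\<lambda>q. Y q f) - Y p (\<lambda>q. X q f) else 0)"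

text \<open>Smooth real 1-forms on \<open>U\<close>, extended complex linearly to \<open>\<complex>TM\<close>.\<close>

definition real_one_form ::
  "('a, 'e::euclidean_space) mfd \<Rightarrow> 'a set \<Rightarrow> ('a \<Rightarrow> 'a ctvec \<Rightarrow> complex) \<Rightarrow> bool" where
  "real_one_form M U \<xi> \<longleftrightarrow> openin (mtop M) U \<and>
     (\<forall>p\<in>U. (\<forall>v\<in>ctangent M p. \<forall>w\<in>ctangent M p. \<xi> p (v + w) = \<xi> p v + \<xi> p w) \<and>
            (\<forall>c. \<forall>v\<in>ctangent M p. \<xi> p (c *\<^sub>c v) = c * \<xi> p v) \<and>
            (\<forall>v\<in>tangent M p. \<xi> p v \<in> \<real>)) \<and>
     (\<forall>V X. V \<subseteq> U \<longrightarrow> smooth_field M V X \<longrightarrow> smooth_fun M V (\<lambda>q. \<xi> q (X q)))"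

definition differential :: "('a \<Rightarrow> real) \<Rightarrow> 'a \<Rightarrow> 'a ctvec \<Rightarrow> complex" where
  "differential \<rho> p v = v (\<lambda>x. complex_of_real (\<rho> x))"

text \<open>\<open>d\<xi>\<close> at \<open>p\<close>, evaluated on vectors \<open>v, w\<close>: the common value of
  \<open>X \<xi>(Y) - Y \<xi>(X) - \<xi>([X,Y])\<close> at \<open>p\<close> over all smooth local extensions \<open>X, Y\<close> of \<open>v, w\<close>.\<close>

definition ext_deriv ::
  "('a, 'e::euclidean_space) mfd \<Rightarrow> ('a \<Rightarrow> 'a ctvec \<Rightarrow> complex) \<Rightarrow> 'a \<Rightarrow> 'a ctvec \<Rightarrow> 'a ctvec \<Rightarrow> complex"
  where
  "ext_deriv M \<xi> p v w = (THE c. \<forall>U X Y.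
     p \<in> U \<longrightarrow> smooth_field M U X \<longrightarrow> smooth_field M U Y \<longrightarrow> X p = v \<longrightarrow> Y p = w \<longrightarrow>
     c = X p (\<lambda>q. \<xi> q (Y q)) - Y p (\<lambda>q. \<xi> q (X q)) - \<xi> p (lie_bracket M X Y p))"


section \<open>Almost-CR manifolds and the Levi form\<close>

text \<open>\<open>T p\<close> is the fibre of \<open>T\<^sup>0\<^sup>,\<^sup>1M\<close> at \<open>p\<close>; \<open>m\<close> is its complex rank. Smoothness of the
  subbundle means that it has smooth local frames.\<close>

definition almost_CR :: "('a, 'e::euclidean_space) mfd \<Rightarrow> ('a \<Rightarrow> 'a ctvec set) \<Rightarrow> bool" where
  "almost_CR M T \<longleftrightarrow> smooth_manifold M \<and>
     (\<exists>m::nat. \<forall>p\<in>topspace (mtop M). \<exists>U L. p \<in> U \<and> (\<forall>k<m. smooth_field M U (L k)) \<and>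
        openin (mtop M) U \<and>
        (\<forall>q\<in>U. inj_on (\<lambda>k. L k q) {..<m} \<and> cindependent ((\<lambda>k. L k q) ` {..<m}) \<and>
               T q = cspan ((\<lambda>k. L k q) ` {..<m}))) \<and>
     (\<forall>p\<in>topspace (mtop M). T p \<inter> conj_vec ` T p = {0})"

definition cr_section ::
  "('a, 'e::euclidean_space) mfd \<Rightarrow> ('a \<Rightarrow> 'a ctvec set) \<Rightarrow> 'a set \<Rightarrow> ('a \<Rightarrow> 'a ctvec) \<Rightarrow> bool" where
  "cr_section M T U Z \<longleftrightarrow> smooth_field M U Z \<and> (\<forall>q\<in>U. Z q \<in> T q)"

definition HM :: "('a \<Rightarrow> 'a ctvec set) \<Rightarrow> 'a \<Rightarrow> 'a ctvec set" where
  "HM T p = Re_vec ` T p"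

text \<open>The projection \<open>\<pi>\<^sub>M\<close> at \<open>p\<close>; elements of the quotient are cosets of \<open>H\<^sub>pM\<close>.\<close>

definition quot_proj :: "('a \<Rightarrow> 'a ctvec set) \<Rightarrow> 'a \<Rightarrow> 'a ctvec \<Rightarrow> 'a ctvec set" where
  "quot_proj T p v = {v + h | h. h \<in> HM T p}"

text \<open>Vectors are functions, so the tensor product of vectors is realised as the corresponding
  function of two arguments (for spaces of functions this is a faithful model of the algebraic
  tensor product).\<close>

definition tensor :: "'a ctvec \<Rightarrow> 'a ctvec \<Rightarrow> ('a \<Rightarrow> complex) \<Rightarrow> ('a \<Rightarrow> complex) \<Rightarrow> complex"
  (infixl \<open>\<otimes>\<^sub>t\<close> 70) where
  "v \<otimes>\<^sub>t w = (\<lambda>f g. v f * w g)"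

type_synonym 'a ctensor = "('a \<Rightarrow> complex) \<Rightarrow> ('a \<Rightarrow> complex) \<Rightarrow> complex"

definition H11 :: "('a \<Rightarrow> 'a ctvec set) \<Rightarrow> 'a \<Rightarrow> 'a ctensor set" where
  "H11 T p = convex hull {Z \<otimes>\<^sub>t conj_vec Z | Z. Z \<in> T p}"

text \<open>Linear extension: \<open>levi M T p \<tau>\<close> is the common value of \<open>\<Sum>\<^sub>j c\<^sub>j (-\<pi>\<^sub>M(i[Z\<^sub>j, Z\<^sub>j conjugate]\<^sub>p))\<close>
  over all representations \<open>\<tau> = \<Sum>\<^sub>j c\<^sub>j Z\<^sub>j(p) \<otimes> Z\<^sub>j(p) conjugate\<close> with real \<open>c\<^sub>j\<close> and local
  sections \<open>Z\<^sub>j\<close> of \<open>T\<^sup>0\<^sup>,\<^sup>1M\<close>.\<close>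

definition levi ::
  "('a, 'e::euclidean_space) mfd \<Rightarrow> ('a \<Rightarrow> 'a ctvec set) \<Rightarrow> 'a \<Rightarrow> 'a ctensor \<Rightarrow> 'a ctvec set" where
  "levi M T p \<tau> = (THE q. \<forall>U (n::nat) c Z.
     p \<in> U \<longrightarrow> openin (mtop M) U \<longrightarrow> (\<forall>j<n. cr_section M T U (Z j)) \<longrightarrow>
     \<tau> = (\<Sum>j<n. c j *\<^sub>R (Z j p \<otimes>\<^sub>t conj_vec (Z j p))) \<longrightarrow>
     q = quot_proj T p
           (- (\<Sum>j<n. c j *\<^sub>R (\<i> *\<^sub>c lie_bracket M (Z j) (\<lambda>x. conj_vec (Z j x)) p))))"

definition ker_levi ::
  "('a, 'e::euclidean_space) mfd \<Rightarrow> ('a \<Rightarrow> 'a ctvec set) \<Rightarrow> 'a \<Rightarrow> 'a ctensor set" where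
  "ker_levi M T p = {\<tau> \<in> H11 T p. \<tau> \<noteq> 0 \<and> levi M T p \<tau> = quot_proj T p 0}"


section \<open>The operator \<open>dd\<^sup>c\<close>\<close>

definition dc_form ::
  "('a, 'e::euclidean_space) mfd \<Rightarrow> ('a \<Rightarrow> 'a ctvec set) \<Rightarrow> ('a \<Rightarrow> real) \<Rightarrow> 'a set \<Rightarrow>
   ('a \<Rightarrow> 'a ctvec \<Rightarrow> complex) \<Rightarrow> bool" where
  "dc_form M T \<rho> U \<xi> \<longleftrightarrow> real_one_form M U \<xi> \<and>
     (\<forall>q\<in>U. \<forall>Z\<in>T q. differential \<rho> q Z + \<i> * \<xi> q Z = 0)"

text \<open>The common value of \<open>i/2 \<Sum>\<^sub>j d\<xi>(Z\<^sub>j, Z\<^sub>j conjugate)\<close> over all admissible \<open>\<xi>\<close> near \<open>p\<close> and all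
  representations of \<open>\<tau>\<close>.\<close>

definition ddc ::
  "('a, 'e::euclidean_space) mfd \<Rightarrow> ('a \<Rightarrow> 'a ctvec set) \<Rightarrow> ('a \<Rightarrow> real) \<Rightarrow> 'a \<Rightarrow> 'a ctensor \<Rightarrow> complex"
  where
  "ddc M T \<rho> p \<tau> = (THE c. \<forall>U \<xi> (n::nat) Z.
     p \<in> U \<longrightarrow> dc_form M T \<rho> U \<xi> \<longrightarrow> (\<forall>j<n. Z j \<in> T p) \<longrightarrow>
     \<tau> = (\<Sum>j<n. Z j \<otimes>\<^sub>t conj_vec (Z j)) \<longrightarrow>
     c = \<i> / 2 * (\<Sum>j<n. ext_deriv M \<xi> p (Z j) (conj_vec (Z j))))"

end

theory Submission
  imports Defs
begin

text \<open>Put \<open>\<sigma> = \<rho>\<^sub>1 - \<rho>\<^sub>2\<close>, and let \<open>\<theta>\<^sub>k\<close> be 1-forms dual to a local frame \<open>L\<^sub>k\<close> of \<open>T\<^sup>0\<^sup>,\<^sup>1M\<close>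
  and vanishing on the conjugate frame. The real form
  \<open>\<eta> = \<Sum>\<^sub>k i (L\<^sub>k \<sigma>) \<theta>\<^sub>k + conjugate\<close> satisfies \<open>d\<sigma> + i \<eta> = 0\<close> on \<open>T\<^sup>0\<^sup>,\<^sup>1M\<close>, so \<open>\<xi> \<mapsto> \<xi> + \<eta>\<close> turns
  an admissible form for \<open>\<rho>\<^sub>2\<close> into one for \<open>\<rho>\<^sub>1\<close>. As the 2-jet of \<open>\<sigma>\<close> vanishes at the base
  point, the coefficients \<open>i L\<^sub>k \<sigma>\<close> vanish there to first order (Hadamard's lemma), hence so do \<open>\<eta>\<close>
  and \<open>d\<eta>\<close>. Thus \<open>d\<xi>\<close> and \<open>d(\<xi> + \<eta>)\<close> coincide at the base point.\<close>

section \<open>Maps of class \<open>C\<^sup>k\<close>\<close>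

text \<open>Tangent vectors are abstract derivations without a coordinate expression, so
  \<open>v f = 0\<close> has to be drawn from the Leibniz rule alone. This is why Hadamard's lemma
  must also control the first derivatives of its factors: the second order statement about \<sigma>
  is Leibniz applied twice. The same abstraction makes dual forms constructible: a nonzero vector is
  a nonzero functional, hence detected by the differential of some smooth function. The conjugate
  frame joins the family so that the \<theta> vanish on it; the conjugate summand that makes \<eta>
  real is then invisible on the CR bundle. Independence of the joint family comes from the bundle
  meeting its conjugate only in 0. \<open>ddc\<close> and \<open>ext_deriv\<close> are definite
  descriptions. They are compared through their defining conditions: adding \<eta> carries one
  condition into the other, so both descriptions select the same value. That \<eta> lives only near
  the base point is harmless, since the condition for \<open>ddc\<close> ranges over forms on
  arbitrary neighbourhoods.\<close>

lemma Ck_on_subset: "Ck_on k S f \<Longrightarrow> T \<subseteq> S \<Longrightarrow> Ck_on k T f"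
  by (induction k arbitrary: f) (auto intro: continuous_on_subset)

text \<open>\<open>frechet_derivative\<close> chooses some derivative, and both functions have
  exactly the same candidates \<open>D\<close>. The argument therefore covers points without a
  derivative as well.\<close>

lemma frechet_derivative_cong_open:
  assumes "open S" "x \<in> S" "\<And>y. y \<in> S \<Longrightarrow> f y = g y"
  shows "frechet_derivative f (at x) = frechet_derivative g (at x)"
proof -
  have "(f has_derivative D) (at x) = (g has_derivative D) (at x)" for D
    using has_derivative_transform_within_open[OF _ assms(1,2), of f D UNIV g]
      has_derivative_transform_within_open[OF _ assms(1,2), of g D UNIV f] assms(3) by auto
  then show ?thesis by (simp add: frechet_derivative_def)
qed

lemma Ck_on_cong:
  assumes "open S" "\<And>x. x \<in> S \<Longrightarrow> f x = g x" "Ck_on k S f"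
  shows "Ck_on k S g"
  using assms(2,3)
proof (induction k arbitrary: f g)
  case 0
  then show ?case by (simp cong: continuous_on_cong)
next
  case (Suc k)
  have "g differentiable (at x)" if "x \<in> S" for x
    using Suc.prems that assms(1) has_derivative_transform_within_open[of f _ x UNIV S g]
    by (fastforce simp: differentiable_def)
  moreover have "Ck_on k S (\<lambda>x. frechet_derivative g (at x) v)" for v
    using Suc.IH[of "\<lambda>x. frechet_derivative f (at x) v"] Suc.prems
      frechet_derivative_cong_open[OF assms(1), of _ f g] by auto
  ultimately show ?case by simp
qed

lemma Ck_on_SucD: "Ck_on (Suc k) S f \<Longrightarrow> Ck_on k S f"
proof (induction k arbitrary: f)
  case 0
  then show ?case
    by (simp add: continuous_at_imp_continuous_on differentiable_imp_continuous_within)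
next
  case (Suc k)
  then show ?case by (metis Ck_on.simps(2))
qed

text \<open>Lets the closure lemmas use the derivative formulas of the calculus rules in place of
  the chosen \<open>frechet_derivative\<close>.\<close>

lemma Ck_on_SucI:
  assumes "open S" "\<And>x. x \<in> S \<Longrightarrow> (f has_derivative f' x) (at x)"
    and "\<And>v. Ck_on k S (\<lambda>x. f' x v)"
  shows "Ck_on (Suc k) S f"
proof -
  have "frechet_derivative f (at x) = f' x" if "x \<in> S" for x
    using frechet_derivative_at[OF assms(2)[OF that]] by simp
  then show ?thesis
    using assms(2) by (auto simp: differentiable_def intro!: Ck_on_cong[OF assms(1) _ assms(3)])
qed

lemma Ck_on_has_derivative:
  "Ck_on (Suc k) S f \<Longrightarrow> x \<in> S \<Longrightarrow> (f has_derivative frechet_derivative f (at x)) (at x)"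
  by (simp add: frechet_derivative_works)

lemma Ck_on_const: "open S \<Longrightarrow> Ck_on k S (\<lambda>x. c)"
proof (induction k arbitrary: c)
  case (Suc k)
  then show ?case by (intro Ck_on_SucI[where f' = "\<lambda>x v. 0"]) auto
qed auto

lemma Ck_on_bounded_linear:
  assumes "open S" "bounded_linear T" "Ck_on k S f"
  shows "Ck_on k S (\<lambda>x. T (f x))"
  using assms(3)
proof (induction k arbitrary: f)
  case 0
  then show ?case using assms(2) bounded_linear.continuous_on by fastforce
next
  case (Suc k)
  show ?case
    by (rule Ck_on_SucI[OF assms(1) bounded_linear.has_derivative[OF assms(2)
          Ck_on_has_derivative[OF Suc.prems]]]) (use Suc in auto)
qed

lemma Ck_on_add:
  assumes "open S" "Ck_on k S f" "Ck_on k S g"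
  shows "Ck_on k S (\<lambda>x. f x + g x)"
  using assms(2,3)
proof (induction k arbitrary: f g)
  case 0
  then show ?case by (auto intro: continuous_intros)
next
  case (Suc k)
  show ?case
    by (rule Ck_on_SucI[OF assms(1) has_derivative_add[OF 
          Ck_on_has_derivative[OF Suc.prems(1)] Ck_on_has_derivative[OF Suc.prems(2)]]])
      (use Suc in auto)
qed

lemma Ck_on_sum:
  assumes "open S" "\<And>i. i \<in> I \<Longrightarrow> Ck_on k S (f i)"
  shows "Ck_on k S (\<lambda>x. \<Sum>i\<in>I. f i x)"
  using assms(2)
  by (induction I rule: infinite_finite_induct) (auto intro: Ck_on_const Ck_on_add assms(1))

text \<open>Each summand of the product rule pairs one undifferentiated argument with a derivative
  of the other, so the induction also uses both arguments at the lower order.\<close>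

lemma Ck_on_bilinear:
  assumes "open S" "bounded_bilinear B" "Ck_on k S f" "Ck_on k S g"
  shows "Ck_on k S (\<lambda>x. B (f x) (g x))"
  using assms(3,4)
proof (induction k arbitrary: f g)
  case 0
  then show ?case by (auto intro: bounded_bilinear.continuous_on[OF assms(2)])
next
  case (Suc k)
  show ?case
    by (rule Ck_on_SucI[OF assms(1) bounded_bilinear.FDERIV[OF assms(2)
          Ck_on_has_derivative[OF Suc.prems(1)] Ck_on_has_derivative[OF Suc.prems(2)]]])
      (use Suc in \<open>auto intro!: Ck_on_add assms(1) Suc.IH dest!: Ck_on_SucD[of k S f] Ck_on_SucD[of k S g]
         simp del: Ck_on.simps, auto\<close>)
qed

text \<open>The derivative formula contains the inverse itself, but only at the lower order, which
  the induction hypothesis supplies.\<close>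

lemma Ck_on_inverse:
  fixes f :: "'e::euclidean_space \<Rightarrow> 'b::real_normed_field"
  assumes "open S" "Ck_on k S f" "\<And>x. x \<in> S \<Longrightarrow> f x \<noteq> 0"
  shows "Ck_on k S (\<lambda>x. inverse (f x))"
  using assms(2)
proof (induction k)
  case 0
  then show ?case using assms(3) by (auto intro: continuous_intros)
next
  case (Suc k)
  then have IH: "Ck_on k S (\<lambda>x. inverse (f x))" by (blast dest: Ck_on_SucD)
  have "Ck_on k S (\<lambda>x. - (inverse (f x) * frechet_derivative f (at x) v * inverse (f x)))" for v
    using Suc.prems
    by (intro Ck_on_bounded_linear[OF assms(1) bounded_linear_minus[OF bounded_linear_ident]]
        Ck_on_bilinear[OF assms(1) bounded_bilinear_mult] IH) auto
  then show ?case
    by (intro Ck_on_SucI[OF assms(1) Deriv.has_derivative_inverse[OF assms(3)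
          Ck_on_has_derivative[OF Suc.prems]]]) auto
qed

text \<open>\<open>Ck_on\<close> speaks about derivatives in a fixed direction. Expanding in the
  basis handles directions that vary with the point.\<close>

lemma frechet_derivative_expand:
  fixes f :: "'e::euclidean_space \<Rightarrow> 'b::real_normed_vector"
  assumes "f differentiable (at x)"
  shows "frechet_derivative f (at x) v = (\<Sum>b\<in>Basis. (v \<bullet> b) *\<^sub>R frechet_derivative f (at x) b)"
proof -
  have lin: "linear (frechet_derivative f (at x))" by (rule linear_frechet_derivative[OF assms])
  have "frechet_derivative f (at x) v = frechet_derivative f (at x) (\<Sum>b\<in>Basis. (v \<bullet> b) *\<^sub>R b)"
    by (simp add: euclidean_representation)
  then show ?thesis by (simp add: linear_sum[OF lin] linear_cmul[OF lin])
qed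

lemma Ck_on_compose:
  fixes f :: "'e::euclidean_space \<Rightarrow> 'd::euclidean_space" and g :: "'d \<Rightarrow> 'b::real_normed_vector"
  assumes "open S" "open T" "f ` S \<subseteq> T" "Ck_on k S f" "Ck_on k T g"
  shows "Ck_on k S (\<lambda>x. g (f x))"
  using assms(4,5)
proof (induction k arbitrary: g)
  case 0
  then show ?case using assms(3) by (auto intro: continuous_on_compose2)
next
  case (Suc k)
  \<comment> \<open>The chain rule differentiates \<open>g\<close> in the direction
    \<open>f' x v\<close>, which moves with \<open>x\<close>. After expansion every factor is a
    derivative in a fixed direction.\<close>
  have *: "((\<lambda>x. g (f x)) has_derivative
     (\<lambda>v. \<Sum>b\<in>Basis. (frechet_derivative f (at x) v \<bullet> b) *\<^sub>R frechet_derivative g (at (f x)) b)) (at x)"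
    if x: "x \<in> S" for x
  proof -
    have fx: "f x \<in> T" using assms(3) x by auto
    then have "g differentiable (at (f x))" using Suc.prems by simp
    note exp = frechet_derivative_expand[OF this]
    show ?thesis
      using has_derivative_compose[OF Ck_on_has_derivative[OF Suc.prems(1) x]
          Ck_on_has_derivative[OF Suc.prems(2) fx]]
      by (subst (asm) exp)
  qed
  show ?case
  proof (rule Ck_on_SucI[OF assms(1) *])
    fix v
    have "Ck_on k S (\<lambda>x. frechet_derivative g (at (f x)) b)" for b
      using Suc.IH[OF Ck_on_SucD[OF Suc.prems(1)], of "\<lambda>y. frechet_derivative g (at y) b"] Suc.prems(2)
      by simp
    moreover have "Ck_on k S (\<lambda>x. frechet_derivative f (at x) v \<bullet> b)" for b
      using Suc.prems(1) by (intro Ck_on_bounded_linear[OF assms(1) bounded_linear_inner_left]) auto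
    ultimately show "Ck_on k S (\<lambda>x. \<Sum>b\<in>Basis. (frechet_derivative f (at x) v \<bullet> b) *\<^sub>R frechet_derivative g (at (f x)) b)"
      by (intro Ck_on_sum Ck_on_bilinear[OF assms(1) bounded_bilinear_scaleR] assms(1))
  qed auto
qed

section \<open>Hadamard's lemma\<close>

text \<open>Differentiation under the integral. Each differentiation in \<open>x\<close> brings out
  one factor \<open>t\<close>, so the integrals with weights \<open>t ^ j\<close> form a family
  closed under differentiation.\<close>

lemma ray_integral_has_derivative:
  fixes h :: "'e::euclidean_space \<Rightarrow> 'b::banach"
  assumes "Ck_on 1 (ball x0 r) h" "x \<in> ball x0 r"
  shows "((\<lambda>x. integral {0..1} (\<lambda>t. t ^ j *\<^sub>R h (x0 + t *\<^sub>R (x - x0)))) has_derivative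
    (\<lambda>v. integral {0..1} (\<lambda>t. t ^ Suc j *\<^sub>R frechet_derivative h (at (x0 + t *\<^sub>R (x - x0))) v))) (at x)"
proof -
  let ?B = "ball x0 r" and ?y = "\<lambda>x t. x0 + t *\<^sub>R (x - x0)"
  have y: "?y x t \<in> ?B" if "x \<in> ?B" "t \<in> cbox 0 1" for x t
  proof -
    have "dist x0 (?y x t) = t * dist x0 x"
      using that by (simp add: dist_norm norm_minus_commute)
    also have "\<dots> \<le> dist x0 x" using that by (simp add: mult_left_le_one_le)
    finally show ?thesis using that by simp
  qed
  have h': "(h has_derivative frechet_derivative h (at z)) (at z)" if "z \<in> ?B" for z
    using Ck_on_has_derivative[of 0 ?B h z] assms(1) that by simp
  have cont_h: "continuous_on ?B h"
    using Ck_on_SucD[of 0 ?B h] assms(1) by simp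
  \<comment> \<open>The Leibniz rule for integrals asks for a jointly continuous derivative with
    values in the bounded linear maps. In finite dimension continuity in each direction is
    enough.\<close>
  define D where "D z = Blinfun (frechet_derivative h (at z))" for z
  have D: "blinfun_apply (D z) = frechet_derivative h (at z)" if "z \<in> ?B" for z
    unfolding D_def using h'[OF that] by (intro bounded_linear_Blinfun_apply has_derivative_bounded_linear)
  have cont_D: "continuous_on ?B D"
  proof (rule continuous_on_blinfun_componentwise)
    fix i :: 'e
    have "continuous_on ?B (\<lambda>z. frechet_derivative h (at z) i)" using assms(1) by simp
    then show "continuous_on ?B (\<lambda>z. blinfun_apply (D z) i)" by (simp add: D cong: continuous_on_cong_simp)
  qed
  have cy: "continuous_on (?B \<times> cbox 0 1) (\<lambda>(x, t). ?y x t)"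
    by (auto simp: case_prod_beta intro!: continuous_intros)
  let ?fx = "\<lambda>x t. t ^ Suc j *\<^sub>R D (?y x t)"
  have cont: "continuous_on (?B \<times> cbox 0 1) (\<lambda>(x, t). ?fx x t)"
    using continuous_on_compose2[OF cont_D cy] y
    by (auto simp: case_prod_beta image_subset_iff intro!: continuous_intros)
  have "((\<lambda>x. integral (cbox 0 1) (\<lambda>t. t ^ j *\<^sub>R h (?y x t))) has_derivative
      blinfun_apply (integral (cbox 0 1) (?fx x))) (at x within ?B)"
  proof (rule leibniz_rule[OF _ _ cont assms(2) convex_ball])
    fix x and t :: real assume *: "x \<in> ?B" "t \<in> cbox 0 1"
    have "((\<lambda>x. t ^ j *\<^sub>R h (?y x t)) has_derivative
       (\<lambda>v. t ^ j *\<^sub>R frechet_derivative h (at (?y x t)) (t *\<^sub>R v))) (at x within ?B)"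
    proof (intro has_derivative_scaleR_right has_derivative_compose[of "\<lambda>x. ?y x t", OF _ h'[OF y[OF *]]])
      show "((\<lambda>x. ?y x t) has_derivative (\<lambda>v. t *\<^sub>R v)) (at x within ?B)"
        by (auto intro!: derivative_eq_intros)
    qed
    moreover have "frechet_derivative h (at (?y x t)) (t *\<^sub>R v) = t *\<^sub>R frechet_derivative h (at (?y x t)) v" for v
      using h'[OF y[OF *]] by (simp add: has_derivative_bounded_linear linear_cmul bounded_linear.linear)
    ultimately show "((\<lambda>x. t ^ j *\<^sub>R h (?y x t)) has_derivative blinfun_apply (?fx x t)) (at x within ?B)"
      by (auto elim!: has_derivative_eq_rhs simp: fun_eq_iff blinfun.scaleR_left D[OF y[OF *]] mult.commute)
  next
    fix x assume "x \<in> ?B"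
    then show "(\<lambda>t. t ^ j *\<^sub>R h (?y x t)) integrable_on cbox 0 1"
      using y by (intro integrable_continuous continuous_intros continuous_on_compose2[OF cont_h]) auto
  qed
  then have der: "((\<lambda>x. integral {0..1} (\<lambda>t. t ^ j *\<^sub>R h (?y x t))) has_derivative
      blinfun_apply (integral {0..1} (?fx x))) (at x)"
    using assms(2) by (simp add: at_within_open[OF _ open_ball])
  have "blinfun_apply (integral {0..1} (?fx x)) v =
    integral {0..1} (\<lambda>t. t ^ Suc j *\<^sub>R frechet_derivative h (at (?y x t)) v)" for v
  proof -
    have "Pair x ` {0..1::real} \<subseteq> ?B \<times> cbox 0 1" using assms(2) by auto
    then have "continuous_on {0..1} (?fx x)"
      using continuous_on_compose2[OF cont, of "{0..1}" "Pair x"] by (simp add: continuous_on_Pair)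
    then have "?fx x integrable_on {0..1}" by (rule integrable_continuous_real)
    then have "blinfun_apply (integral {0..1} (?fx x)) v = integral {0..1} (\<lambda>t. ?fx x t v)"
      by (rule blinfun_apply_integral)
    also have "\<dots> = integral {0..1} (\<lambda>t. t ^ Suc j *\<^sub>R frechet_derivative h (at (?y x t)) v)"
      by (intro integral_cong) (use D y[OF assms(2)] in \<open>simp add: blinfun.scaleR_left\<close>)
    finally show ?thesis .
  qed
  with der show ?thesis by (auto elim!: has_derivative_eq_rhs simp: fun_eq_iff)
qed

text \<open>One order is given up because even continuity of the integral is read off from its
  differentiability. The weight varies in the induction, as each derivative raises
  \<open>j\<close>.\<close>

lemma ray_integral_Ck_on:
  fixes h :: "'e::euclidean_space \<Rightarrow> 'b::banach"
  assumes "Ck_on (Suc k) (ball x0 r) h"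
  shows "Ck_on k (ball x0 r) (\<lambda>x. integral {0..1} (\<lambda>t. t ^ j *\<^sub>R h (x0 + t *\<^sub>R (x - x0))))"
  using assms
proof (induction k arbitrary: h j)
  case 0
  then show ?case
    using ray_integral_has_derivative[of x0 r h _ j]
    by (auto intro!: continuous_at_imp_continuous_on has_derivative_continuous)
next
  case (Suc k)
  have "Ck_on 1 (ball x0 r) h" using Suc.prems by (induction k) (auto dest: Ck_on_SucD simp del: Ck_on.simps)
  from ray_integral_has_derivative[OF this] show ?case
  proof (rule Ck_on_SucI[OF open_ball])
    fix v
    have "Ck_on (Suc k) (ball x0 r) (\<lambda>z. frechet_derivative h (at z) v)"
      using Suc.prems by (subst (asm) Ck_on.simps) blast
    from Suc.IH[OF this, of "Suc j"]
    show "Ck_on k (ball x0 r) (\<lambda>x. integral {0..1} (\<lambda>t. t ^ Suc j *\<^sub>R frechet_derivative h (at (x0 + t *\<^sub>R (x - x0))) v))" .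
  qed
qed

lemma smooth_on_frechet: "smooth_on S f \<Longrightarrow> smooth_on S (\<lambda>x. frechet_derivative f (at x) v)"
  unfolding smooth_on_def using Ck_on.simps(2) by blast

lemma smooth_on_differentiable: "smooth_on S f \<Longrightarrow> x \<in> S \<Longrightarrow> f differentiable (at x)"
  unfolding smooth_on_def using Ck_on.simps(2) by blast

text \<open>The fundamental theorem of calculus along the ray from \<open>x0\<close> to
  \<open>x\<close>. The derivative of \<open>g b\<close> at \<open>x0\<close> is the integral of
  \<open>t\<close> times a second derivative of \<open>f\<close> at \<open>x0\<close>, that is, half
  of it; this gives the last conclusion.\<close>

lemma Hadamard:
  fixes f :: "'e::euclidean_space \<Rightarrow> 'b::banach"
  assumes f: "smooth_on (ball x0 r) f" and r: "0 < r"
  obtains g where "\<And>b. smooth_on (ball x0 r) (g b)"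
    and "\<And>x. x \<in> ball x0 r \<Longrightarrow> f x = f x0 + (\<Sum>b\<in>Basis. ((x - x0) \<bullet> b) *\<^sub>R g b x)"
    and "\<And>b. g b x0 = frechet_derivative f (at x0) b"
    and "\<And>b v. frechet_derivative (\<lambda>x. frechet_derivative f (at x) b) (at x0) v = 0 \<Longrightarrow>
       frechet_derivative (g b) (at x0) v = 0"
proof -
  let ?B = "ball x0 r"
  \<comment> \<open>The weight \<open>t ^ 0\<close> keeps \<open>g\<close> literally an instance of
    the family of ray integrals.\<close>
  define g where "g b x = integral {0..1} (\<lambda>t. t ^ 0 *\<^sub>R frechet_derivative f (at (x0 + t *\<^sub>R (x - x0))) b)" for b x
  have smf: "smooth_on ?B (\<lambda>x. frechet_derivative f (at x) b)" for b
    using f by (rule smooth_on_frechet)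
  then have sm: "smooth_on ?B (g b)" for b
    unfolding smooth_on_def g_def by (intro allI ray_integral_Ck_on) blast
  have d0: "frechet_derivative (g b) (at x0) v = 0"
    if "frechet_derivative (\<lambda>x. frechet_derivative f (at x) b) (at x0) v = 0" for b v
  proof -
    have "Ck_on 1 ?B (\<lambda>x. frechet_derivative f (at x) b)" using smf unfolding smooth_on_def by blast
    from frechet_derivative_at[OF ray_integral_has_derivative[OF this, of x0 0]] r
    have "frechet_derivative (g b) (at x0) =
        (\<lambda>v. integral {0..1} (\<lambda>t. t ^ Suc 0 *\<^sub>R frechet_derivative (\<lambda>x. frechet_derivative f (at x) b) (at x0) v))"
      unfolding g_def by simp
    then show ?thesis using that by simp
  qed
  have exp: "f x = f x0 + (\<Sum>b\<in>Basis. ((x - x0) \<bullet> b) *\<^sub>R g b x)" if x: "x \<in> ?B" for x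
  proof -
    let ?y = "\<lambda>t. x0 + t *\<^sub>R (x - x0)"
    have y: "?y t \<in> ?B" if "t \<in> {0..1}" for t
    proof -
      have "dist x0 (?y t) = t * dist x0 x"
        using that by (simp add: dist_norm norm_minus_commute)
      also have "\<dots> \<le> dist x0 x" using that by (simp add: mult_left_le_one_le)
      finally show ?thesis using x by simp
    qed
    have "((\<lambda>t. frechet_derivative f (at (?y t)) (x - x0)) has_integral (f (?y 1) - f (?y 0))) {0..1}"
    proof (rule fundamental_theorem_of_calculus)
      fix t :: real assume t: "t \<in> {0..1}"
      have D: "(f has_derivative frechet_derivative f (at (?y t))) (at (?y t))"
        using smooth_on_differentiable[OF f y[OF t]] by (simp add: frechet_derivative_works)
      have "((\<lambda>t. f (?y t)) has_derivative (\<lambda>s. frechet_derivative f (at (?y t)) (s *\<^sub>R (x - x0)))) (at t within {0..1})"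
        by (rule has_derivative_compose[of ?y, OF _ D]) (auto intro!: derivative_eq_intros)
      then show "((\<lambda>t. f (?y t)) has_vector_derivative frechet_derivative f (at (?y t)) (x - x0)) (at t within {0..1})"
        using D by (simp add: has_vector_derivative_def linear_cmul bounded_linear.linear has_derivative_bounded_linear)
    qed auto
    then have "f x - f x0 = integral {0..1} (\<lambda>t. frechet_derivative f (at (?y t)) (x - x0))"
      by (auto simp: integral_unique)
    also have "\<dots> = integral {0..1} (\<lambda>t. \<Sum>b\<in>Basis. ((x - x0) \<bullet> b) *\<^sub>R frechet_derivative f (at (?y t)) b)"
      by (intro integral_cong frechet_derivative_expand smooth_on_differentiable[OF f] y)
    also have "\<dots> = (\<Sum>b\<in>Basis. ((x - x0) \<bullet> b) *\<^sub>R g b x)"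
    proof -
      have "(\<lambda>t. frechet_derivative f (at (?y t)) b) integrable_on {0..1}" for b
      proof (rule integrable_continuous_real)
        have "continuous_on ?B (\<lambda>z. frechet_derivative f (at z) b)"
          using smf unfolding smooth_on_def using Ck_on.simps(1) by blast
        then show "continuous_on {0..1} (\<lambda>t. frechet_derivative f (at (?y t)) b)"
          by (rule continuous_on_compose2) (use y in \<open>auto intro!: continuous_intros\<close>)
      qed
      then show ?thesis by (subst integral_sum) (auto simp: g_def intro: integrable_cmul)
    qed
    finally show ?thesis by (simp add: algebra_simps)
  qed
  show thesis
    by (rule that[OF sm exp _ d0]) (simp_all add: g_def)
qed

section \<open>Smooth functions and derivations on a manifold\<close>

lemma smooth_on_subset: "smooth_on S f \<Longrightarrow> T \<subseteq> S \<Longrightarrow> smooth_on T f"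
  by (auto simp: smooth_on_def intro: Ck_on_subset)

lemma smooth_on_cong: "open S \<Longrightarrow> (\<And>x. x \<in> S \<Longrightarrow> f x = g x) \<Longrightarrow> smooth_on S f \<Longrightarrow> smooth_on S g"
  unfolding smooth_on_def by (blast intro: Ck_on_cong)

locale smooth_mfd =
  fixes M :: "('a, 'e::euclidean_space) mfd"
  assumes smooth_manifold: "smooth_manifold M"
begin

section \<open>Charts\<close>

lemma
  assumes "(V, \<phi>) \<in> atlas M"
  shows chart_openin: "openin (mtop M) V" and chart_open: "open (\<phi> ` V)"
    and chart_homeo: "homeomorphic_map (subtopology (mtop M) V) (top_of_set (\<phi> ` V)) \<phi>"
  using smooth_manifold assms by (auto simp: smooth_manifold_def)

lemma chart_smooth:
  assumes "(V, \<phi>) \<in> atlas M" "(W, \<psi>) \<in> atlas M"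
  shows "smooth_on (\<phi> ` (V \<inter> W)) (\<psi> \<circ> inv_into V \<phi>)"
  using smooth_manifold assms by (fastforce simp: smooth_manifold_def)

lemma chart_inj:
  assumes "(V, \<phi>) \<in> atlas M"
  shows "inj_on \<phi> V"
proof -
  have "topspace (subtopology (mtop M) V) = V"
    using chart_openin[OF assms] by (auto simp: topspace_subtopology dest: openin_subset)
  then show ?thesis
    using chart_homeo[OF assms] homeomorphic_imp_injective_map by metis
qed

lemma chart_open_image:
  assumes "(V, \<phi>) \<in> atlas M" "openin (mtop M) U"
  shows "open (\<phi> ` (U \<inter> V))"
proof -
  have "openin (subtopology (mtop M) V) (U \<inter> V)"
    using assms(2) by (auto simp: openin_subtopology)
  then have "openin (top_of_set (\<phi> ` V)) (\<phi> ` (U \<inter> V))"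
    using homeomorphic_imp_open_map[OF chart_homeo[OF assms(1)]] by (simp add: open_map_def)
  then show ?thesis using chart_open[OF assms(1)] by (simp add: openin_open_eq)
qed

lemma chart_open_preimage:
  assumes "(V, \<phi>) \<in> atlas M" "open S"
  shows "openin (mtop M) {q \<in> V. \<phi> q \<in> S}"
proof -
  have "continuous_map (subtopology (mtop M) V) (top_of_set (\<phi> ` V)) \<phi>"
    using homeomorphic_imp_continuous_map[OF chart_homeo[OF assms(1)]] .
  then have "continuous_map (subtopology (mtop M) V) euclidean \<phi>"
    using continuous_map_in_subtopology by blast
  then have "openin (subtopology (mtop M) V) {q \<in> topspace (subtopology (mtop M) V). \<phi> q \<in> S}"
    using assms(2) by (simp add: continuous_map_def)
  moreover have "topspace (subtopology (mtop M) V) = V"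
    using chart_openin[OF assms(1)] by (auto simp: topspace_subtopology dest: openin_subset)
  ultimately show ?thesis
    using openin_trans_full[OF _ chart_openin[OF assms(1)]] by metis
qed

lemma chart_exists: "p \<in> topspace (mtop M) \<Longrightarrow> \<exists>V \<phi>. (V, \<phi>) \<in> atlas M \<and> p \<in> V"
  using smooth_manifold by (force simp: smooth_manifold_def)

section \<open>Smooth functions on open sets\<close>

lemma smooth_funI:
  assumes "openin (mtop M) U"
    "\<And>V \<phi>. (V, \<phi>) \<in> atlas M \<Longrightarrow> open (\<phi> ` (U \<inter> V)) \<Longrightarrow> smooth_on (\<phi> ` (U \<inter> V)) (f \<circ> inv_into V \<phi>)"
  shows "smooth_fun M U f"
  using assms chart_open_image by (auto simp: smooth_fun_def)

lemma smooth_fun_openin: "smooth_fun M U f \<Longrightarrow> openin (mtop M) U"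
  by (simp add: smooth_fun_def)

lemma smooth_funD:
  assumes "smooth_fun M U f" "(V, \<phi>) \<in> atlas M"
  shows "smooth_on (\<phi> ` (U \<inter> V)) (f \<circ> inv_into V \<phi>)"
  using assms by (auto simp: smooth_fun_def)

lemma smooth_fun_subset:
  assumes "smooth_fun M U f" "openin (mtop M) W" "W \<subseteq> U"
  shows "smooth_fun M W f"
  by (rule smooth_funI[OF assms(2)], rule smooth_on_subset[OF smooth_funD[OF assms(1)]])
    (use assms(3) in auto)

lemma smooth_fun_cong:
  assumes "smooth_fun M U f" "\<And>q. q \<in> U \<Longrightarrow> f q = g q"
  shows "smooth_fun M U g"
proof (rule smooth_funI[OF smooth_fun_openin[OF assms(1)]])
  fix V \<phi> assume V: "(V, \<phi>) \<in> atlas M" and "open (\<phi> ` (U \<inter> V))"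
  then show "smooth_on (\<phi> ` (U \<inter> V)) (g \<circ> inv_into V \<phi>)"
    by (rule_tac smooth_on_cong[OF _ _ smooth_funD[OF assms(1) V]])
      (auto simp: assms(2) chart_inj inv_into_f_f)
qed

lemma smooth_fun_const: "openin (mtop M) U \<Longrightarrow> smooth_fun M U (\<lambda>q. c)"
  by (rule smooth_funI) (auto simp: smooth_on_def comp_def Ck_on_const)

lemma smooth_fun_bounded_linear:
  assumes "bounded_linear T" "smooth_fun M U f"
  shows "smooth_fun M U (\<lambda>q. T (f q))"
  using smooth_funD[OF assms(2)]
  by (intro smooth_funI smooth_fun_openin[OF assms(2)])
    (auto simp: smooth_on_def comp_def intro!: Ck_on_bounded_linear[OF _ assms(1)])

lemma smooth_fun_add:
  assumes "smooth_fun M U f" "smooth_fun M U g"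
  shows "smooth_fun M U (\<lambda>q. f q + g q)"
  using smooth_funD[OF assms(1)] smooth_funD[OF assms(2)]
  by (intro smooth_funI smooth_fun_openin[OF assms(1)])
    (auto simp: smooth_on_def comp_def intro!: Ck_on_add)

lemma smooth_fun_bilinear:
  assumes "bounded_bilinear B" "smooth_fun M U f" "smooth_fun M U g"
  shows "smooth_fun M U (\<lambda>q. B (f q) (g q))"
  using smooth_funD[OF assms(2)] smooth_funD[OF assms(3)]
  by (intro smooth_funI smooth_fun_openin[OF assms(2)])
    (auto simp: smooth_on_def comp_def intro!: Ck_on_bilinear[OF _ assms(1)])

lemmas smooth_fun_mult = smooth_fun_bilinear[OF bounded_bilinear_mult]
lemmas smooth_fun_cnj = smooth_fun_bounded_linear[OF bounded_linear_cnj]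

lemma smooth_fun_diff:
  assumes "smooth_fun M U f" "smooth_fun M U g"
  shows "smooth_fun M U (\<lambda>q. f q - g q)"
  using smooth_fun_add[OF assms(1) smooth_fun_bounded_linear[OF bounded_linear_minus[OF bounded_linear_ident] assms(2)]]
  by simp

lemma smooth_fun_inverse:
  fixes f :: "'a \<Rightarrow> 'b::real_normed_field"
  assumes f: "smooth_fun M U f" and nz: "\<And>q. q \<in> U \<Longrightarrow> f q \<noteq> 0"
  shows "smooth_fun M U (\<lambda>q. inverse (f q))"
proof (rule smooth_funI[OF smooth_fun_openin[OF f]])
  fix V \<phi> assume V: "(V, \<phi>) \<in> atlas M" and op: "open (\<phi> ` (U \<inter> V))"
  have "(f \<circ> inv_into V \<phi>) x \<noteq> 0" if "x \<in> \<phi> ` (U \<inter> V)" for x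
    using that nz chart_inj[OF V] by (auto simp: inv_into_f_f)
  then show "smooth_on (\<phi> ` (U \<inter> V)) ((\<lambda>q. inverse (f q)) \<circ> inv_into V \<phi>)"
    using smooth_funD[OF f V] Ck_on_inverse[OF op, of _ "f \<circ> inv_into V \<phi>"]
    unfolding smooth_on_def comp_def by blast
qed

text \<open>Continuity in a chart. It provides the room to divide by a function known to be nonzero
  at one point only.\<close>

lemma smooth_fun_nonzero_nbhd:
  assumes f: "smooth_fun M U f" and p: "p \<in> U" and nz: "f p \<noteq> 0"
  obtains W where "openin (mtop M) W" "p \<in> W" "W \<subseteq> U" "\<And>q. q \<in> W \<Longrightarrow> f q \<noteq> 0"
proof -
  have "p \<in> topspace (mtop M)" using p openin_subset[OF smooth_fun_openin[OF f]] by auto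
  then obtain V \<phi> where V: "(V, \<phi>) \<in> atlas M" "p \<in> V" using chart_exists by blast
  let ?F = "f \<circ> inv_into V \<phi>" and ?S = "\<phi> ` (U \<inter> V)"
  have "open ?S" using V(1) smooth_fun_openin[OF f] by (rule chart_open_image)
  moreover have "continuous_on ?S ?F"
    using smooth_funD[OF f V(1)] Ck_on.simps(1) unfolding smooth_on_def by blast
  ultimately have "open (?S \<inter> ?F -` (- {0}))"
    by (auto intro!: continuous_open_preimage)
  then have "openin (mtop M) {q \<in> V. \<phi> q \<in> ?S \<inter> ?F -` (- {0})}"
    by (rule chart_open_preimage[OF V(1)])
  moreover have "{q \<in> V. \<phi> q \<in> ?S \<inter> ?F -` (- {0})} = {q \<in> U \<inter> V. f q \<noteq> 0}"
    using chart_inj[OF V(1)] by (auto simp: inv_into_f_f inj_on_eq_iff)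
  ultimately show thesis using p V(2) nz by (intro that[of "{q \<in> U \<inter> V. f q \<noteq> 0}"]) auto
qed

text \<open>In another chart the pullback is \<open>g\<close> after a transition map.\<close>

lemma smooth_fun_compose_chart:
  assumes V: "(V, \<phi>) \<in> atlas M" and S: "open S" "smooth_on S g"
  shows "smooth_fun M {q \<in> V. \<phi> q \<in> S} (\<lambda>q. g (\<phi> q))"
proof (rule smooth_funI[OF chart_open_preimage[OF V S(1)]])
  fix W \<psi> assume W: "(W, \<psi>) \<in> atlas M" and op: "open (\<psi> ` ({q \<in> V. \<phi> q \<in> S} \<inter> W))"
  let ?A = "\<psi> ` ({q \<in> V. \<phi> q \<in> S} \<inter> W)"
  have "smooth_on ?A (\<phi> \<circ> inv_into W \<psi>)"
    by (rule smooth_on_subset[OF chart_smooth[OF W V]]) auto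
  moreover have "(\<phi> \<circ> inv_into W \<psi>) ` ?A \<subseteq> S"
    using chart_inj[OF W] by (auto simp: inv_into_f_f)
  ultimately show "smooth_on ?A ((\<lambda>q. g (\<phi> q)) \<circ> inv_into W \<psi>)"
    using Ck_on_compose[OF op S(1), of "\<phi> \<circ> inv_into W \<psi>" _ g] S(2)
    by (auto simp: smooth_on_def comp_def)
qed

section \<open>Smoothness at a point\<close>

lemma smooth_at_fun: "smooth_fun M U f \<Longrightarrow> p \<in> U \<Longrightarrow> smooth_at M p f"
  by (auto simp: smooth_at_def)

lemma smooth_at_common:
  assumes "smooth_at M p f" "smooth_at M p g"
  obtains U where "p \<in> U" "smooth_fun M U f" "smooth_fun M U g"
proof -
  obtain U V where "p \<in> U" "smooth_fun M U f" "p \<in> V" "smooth_fun M V g"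
    using assms by (auto simp: smooth_at_def)
  then show thesis
    by (intro that[of "U \<inter> V"]) (auto intro: smooth_fun_subset openin_Int smooth_fun_openin)
qed

lemma smooth_at_add: "smooth_at M p f \<Longrightarrow> smooth_at M p g \<Longrightarrow> smooth_at M p (\<lambda>q. f q + g q)"
  by (erule (1) smooth_at_common) (blast intro: smooth_at_fun smooth_fun_add)

lemma smooth_at_mult:
  fixes f g :: "'a \<Rightarrow> 'b::real_normed_algebra"
  shows "smooth_at M p f \<Longrightarrow> smooth_at M p g \<Longrightarrow> smooth_at M p (\<lambda>q. f q * g q)"
  by (erule (1) smooth_at_common) (blast intro: smooth_at_fun smooth_fun_mult)

lemma smooth_at_cnj: "smooth_at M p f \<Longrightarrow> smooth_at M p (\<lambda>q. cnj (f q))"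
  unfolding smooth_at_def by (blast intro: smooth_fun_cnj)

lemma smooth_at_cnj_iff: "smooth_at M p (\<lambda>q. cnj (f q)) \<longleftrightarrow> smooth_at M p f"
  using smooth_at_cnj[of p f] smooth_at_cnj[of p "\<lambda>q. cnj (f q)"] by auto

lemma smooth_at_const: "p \<in> topspace (mtop M) \<Longrightarrow> smooth_at M p (\<lambda>q. c)"
  by (rule smooth_at_fun[OF smooth_fun_const]) auto

lemma smooth_at_topspace: "smooth_at M p f \<Longrightarrow> p \<in> topspace (mtop M)"
  by (auto simp: smooth_at_def dest: smooth_fun_openin openin_subset)

lemma smooth_at_sum:
  assumes "p \<in> topspace (mtop M)" "\<And>i. i \<in> I \<Longrightarrow> smooth_at M p (f i)"
  shows "smooth_at M p (\<lambda>q. \<Sum>i\<in>I. f i q)"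
  using assms(2)
  by (induction I rule: infinite_finite_induct) (auto intro: smooth_at_const smooth_at_add assms(1))

section \<open>Derivations at a point\<close>

lemma ctangent_nonsmooth: "v \<in> ctangent M p \<Longrightarrow> \<not> smooth_at M p f \<Longrightarrow> v f = 0"
  by (simp add: ctangent_def)

lemma ctangent_add:
  "v \<in> ctangent M p \<Longrightarrow> smooth_at M p f \<Longrightarrow> smooth_at M p g \<Longrightarrow> v (\<lambda>q. f q + g q) = v f + v g"
  by (simp add: ctangent_def)

lemma ctangent_cmult: "v \<in> ctangent M p \<Longrightarrow> smooth_at M p f \<Longrightarrow> v (\<lambda>q. c * f q) = c * v f"
  by (simp add: ctangent_def)

lemma ctangent_mult:
  "v \<in> ctangent M p \<Longrightarrow> smooth_at M p f \<Longrightarrow> smooth_at M p g \<Longrightarrow>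
    v (\<lambda>q. f q * g q) = f p * v g + g p * v f"
  by (simp add: ctangent_def)

text \<open>Leibniz for 1 * 1 gives \<open>v 1 = 2 * v 1\<close>. Off the space no function is
  smooth, and the default value 0 applies.\<close>

lemma ctangent_const:
  assumes v: "v \<in> ctangent M p"
  shows "v (\<lambda>q. c) = 0"
proof (cases "p \<in> topspace (mtop M)")
  case True
  have "v (\<lambda>q. 1) = 0"
    using ctangent_mult[OF v smooth_at_const[OF True, of 1] smooth_at_const[OF True, of 1]] by simp
  then show ?thesis
    using ctangent_cmult[OF v smooth_at_const[OF True, of 1], of c] by simp
next
  case False
  then show ?thesis using ctangent_nonsmooth[OF v] smooth_at_topspace by blast
qed

lemma ctangent_sum:
  assumes v: "v \<in> ctangent M p" and "p \<in> topspace (mtop M)" "\<And>i. i \<in> I \<Longrightarrow> smooth_at M p (f i)"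
  shows "v (\<lambda>q. \<Sum>i\<in>I. f i q) = (\<Sum>i\<in>I. v (f i))"
  using assms(3)
proof (induction I rule: infinite_finite_induct)
  case (insert i I)
  then show ?case using ctangent_add[OF v, of "f i" "\<lambda>q. \<Sum>i\<in>I. f i q"] smooth_at_sum[OF assms(2), of I f]
    by auto
qed (auto simp: ctangent_const[OF v])

text \<open>Multiply by the indicator function of a neighbourhood.\<close>

lemma ctangent_local:
  assumes v: "v \<in> ctangent M p" and f: "smooth_fun M U f" and p: "p \<in> U"
    and eq: "\<And>q. q \<in> U \<Longrightarrow> f q = g q"
  shows "v f = v g"
proof -
  define \<iota> :: "'a \<Rightarrow> complex" where "\<iota> q = (if q \<in> U then 1 else 0)" for q
  have g: "smooth_at M p g" using smooth_at_fun[OF smooth_fun_cong[OF f eq] p] .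
  have f': "smooth_at M p f" using f p by (rule smooth_at_fun)
  \<comment> \<open>The indicator may jump at the boundary of \<open>U\<close>, but it is constant
    on \<open>U\<close>, and smoothness at \<open>p\<close> asks only for a neighbourhood.\<close>
  have \<iota>: "smooth_at M p \<iota>"
    using smooth_fun_cong[OF smooth_fun_const[OF smooth_fun_openin[OF f]], of 1 \<iota>]
    by (auto intro!: smooth_at_fun[OF _ p] simp: \<iota>_def)
  have "(\<lambda>q. \<iota> q * \<iota> q) = \<iota>" by (auto simp: \<iota>_def)
  \<comment> \<open>Idempotence and the value 1 at \<open>p\<close> turn Leibniz into
    \<open>v \<iota> = 2 * v \<iota>\<close>.\<close>
  then have "v \<iota> = 0" using ctangent_mult[OF v \<iota> \<iota>] p by (simp add: \<iota>_def)
  then have "v (\<lambda>q. \<iota> q * f q) = v f" "v (\<lambda>q. \<iota> q * g q) = v g"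
    using ctangent_mult[OF v \<iota> f'] ctangent_mult[OF v \<iota> g] p by (simp_all add: \<iota>_def)
  moreover have "(\<lambda>q. \<iota> q * f q) = (\<lambda>q. \<iota> q * g q)" by (auto simp: \<iota>_def eq)
  ultimately show ?thesis by simp
qed

lemma ctangent_plus: "v \<in> ctangent M p \<Longrightarrow> w \<in> ctangent M p \<Longrightarrow> v + w \<in> ctangent M p"
  by (simp add: ctangent_def algebra_simps)

lemma ctangent_cscale: "v \<in> ctangent M p \<Longrightarrow> c *\<^sub>c v \<in> ctangent M p"
  by (simp add: ctangent_def cscale_def algebra_simps)

lemma ctangent_zero: "0 \<in> ctangent M p"
  by (simp add: ctangent_def)

lemma ctangent_setsum: "(\<And>i. i \<in> I \<Longrightarrow> v i \<in> ctangent M p) \<Longrightarrow> (\<Sum>i\<in>I. v i) \<in> ctangent M p"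
  by (induction I rule: infinite_finite_induct) (auto intro: ctangent_zero ctangent_plus)

lemma ctangent_conj_vec: "v \<in> ctangent M p \<Longrightarrow> conj_vec v \<in> ctangent M p"
  by (simp add: ctangent_def conj_vec_def smooth_at_cnj_iff)

section \<open>Smooth vector fields\<close>

lemma smooth_field_ctangent: "smooth_field M U X \<Longrightarrow> q \<in> U \<Longrightarrow> X q \<in> ctangent M q"
  by (simp add: smooth_field_def)

lemma smooth_field_subset:
  "smooth_field M U X \<Longrightarrow> openin (mtop M) W \<Longrightarrow> W \<subseteq> U \<Longrightarrow> smooth_field M W X"
  unfolding smooth_field_def by blast

lemma smooth_field_apply: "smooth_field M U X \<Longrightarrow> smooth_fun M U f \<Longrightarrow> smooth_fun M U (\<lambda>q. X q f)"
  unfolding smooth_field_def by blast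

lemma smooth_field_openin: "smooth_field M U X \<Longrightarrow> openin (mtop M) U"
  by (simp add: smooth_field_def)

lemma smooth_field_conj_vec:
  assumes "smooth_field M U X"
  shows "smooth_field M U (\<lambda>q. conj_vec (X q))"
  using assms by (auto simp: smooth_field_def ctangent_conj_vec) (simp add: conj_vec_def smooth_fun_cnj)

end

section \<open>Coframes and second order contact\<close>

lemma Ck_on_ident: "open S \<Longrightarrow> Ck_on k S (\<lambda>x. x)"
  by (cases k) (auto intro!: Ck_on_SucI[where f' = "\<lambda>x v. v"] Ck_on_const simp del: Ck_on.simps(2))

section \<open>Conjugation of complex vectors\<close>

lemma conj_vec_add: "conj_vec (v + w) = conj_vec v + conj_vec w"
  by (simp add: conj_vec_def fun_eq_iff)

lemma conj_vec_cscale: "conj_vec (c *\<^sub>c v) = cnj c *\<^sub>c conj_vec v"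
  by (simp add: conj_vec_def cscale_def fun_eq_iff)

lemma conj_vec_conj_vec [simp]: "conj_vec (conj_vec v) = v"
  by (simp add: conj_vec_def)

lemma conj_vec_zero [simp]: "conj_vec 0 = 0"
  by (simp add: conj_vec_def fun_eq_iff)

lemma sum_fun_apply: "(\<Sum>i\<in>I. v i) x = (\<Sum>i\<in>I. v i x)"
  by (induction I rule: infinite_finite_induct) auto

lemma conj_vec_sum: "conj_vec (\<Sum>i\<in>I. v i) = (\<Sum>i\<in>I. conj_vec (v i))"
  by (simp add: conj_vec_def fun_eq_iff sum_fun_apply)

text \<open>As simplification rules these eta-expand sums of functions even when they are not applied.\<close>

declare plus_fun_apply [simp del] zero_fun_apply [simp del]

text \<open>\<open>real_one_form\<close> without the reality clause. Coframe forms and their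
  multiples by complex functions live here; reality appears only after adding the conjugate.\<close>

definition complex_one_form ::
  "('a, 'e::euclidean_space) mfd \<Rightarrow> 'a set \<Rightarrow> ('a \<Rightarrow> 'a ctvec \<Rightarrow> complex) \<Rightarrow> bool" where
  "complex_one_form M U \<xi> \<longleftrightarrow> openin (mtop M) U \<and>
     (\<forall>p\<in>U. (\<forall>v\<in>ctangent M p. \<forall>w\<in>ctangent M p. \<xi> p (v + w) = \<xi> p v + \<xi> p w) \<and>
            (\<forall>c. \<forall>v\<in>ctangent M p. \<xi> p (c *\<^sub>c v) = c * \<xi> p v)) \<and>
     (\<forall>V X. V \<subseteq> U \<longrightarrow> smooth_field M V X \<longrightarrow> smooth_fun M V (\<lambda>q. \<xi> q (X q)))"

lemma real_one_form_iff:
  "real_one_form M U \<xi> \<longleftrightarrow> complex_one_form M U \<xi> \<and> (\<forall>p\<in>U. \<forall>v\<in>tangent M p. \<xi> p v \<in> \<real>)"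
  unfolding real_one_form_def complex_one_form_def by blast

context smooth_mfd
begin

lemma complex_one_form_openin: "complex_one_form M U \<xi> \<Longrightarrow> openin (mtop M) U"
  by (simp add: complex_one_form_def)

lemma complex_one_form_subset:
  "complex_one_form M U \<xi> \<Longrightarrow> openin (mtop M) W \<Longrightarrow> W \<subseteq> U \<Longrightarrow> complex_one_form M W \<xi>"
  unfolding complex_one_form_def by (meson subset_iff subset_trans)

lemma complex_one_form_apply:
  "complex_one_form M U \<xi> \<Longrightarrow> smooth_field M U X \<Longrightarrow> smooth_fun M U (\<lambda>q. \<xi> q (X q))"
  unfolding complex_one_form_def by blast

lemma complex_one_form_differential:
  assumes "smooth_fun M U f"
  shows "complex_one_form M U (\<lambda>q v. v f)"
  unfolding complex_one_form_def
proof (intro conjI ballI allI impI)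
  fix V X assume V: "V \<subseteq> U" and X: "smooth_field M V X"
  show "smooth_fun M V (\<lambda>q. X q f)"
    by (rule smooth_field_apply[OF X smooth_fun_subset[OF assms smooth_field_openin[OF X] V]])
qed (use smooth_fun_openin[OF assms] in \<open>simp_all add: cscale_def plus_fun_apply\<close>)

lemma complex_one_form_add:
  assumes "complex_one_form M U \<xi>" "complex_one_form M U \<eta>"
  shows "complex_one_form M U (\<lambda>q v. \<xi> q v + \<eta> q v)"
  using assms by (auto simp: complex_one_form_def algebra_simps intro!: smooth_fun_add)

lemma complex_one_form_scale:
  assumes \<xi>: "complex_one_form M U \<xi>" and g: "smooth_fun M U g"
  shows "complex_one_form M U (\<lambda>q v. g q * \<xi> q v)"
  using \<xi> smooth_fun_subset[OF g] smooth_field_openin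
  by (auto simp: complex_one_form_def algebra_simps intro!: smooth_fun_mult)

lemma complex_one_form_sum:
  assumes "openin (mtop M) U" "\<And>i. i \<in> I \<Longrightarrow> complex_one_form M U (\<xi> i)"
  shows "complex_one_form M U (\<lambda>q v. \<Sum>i\<in>I. \<xi> i q v)"
  using assms(2)
proof (induction I rule: infinite_finite_induct)
  case (insert i I)
  then show ?case using complex_one_form_add by simp
qed (use assms(1) smooth_field_openin in \<open>auto simp: complex_one_form_def intro!: smooth_fun_const\<close>)

lemma complex_one_form_diff:
  assumes "complex_one_form M U \<xi>" "complex_one_form M U \<eta>"
  shows "complex_one_form M U (\<lambda>q v. \<xi> q v - \<eta> q v)"
  using complex_one_form_add[OF assms(1) complex_one_form_scale[OF assms(2) smooth_fun_const[of U "-1"]]]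
    complex_one_form_openin[OF assms(1)] by simp

lemma complex_one_form_conj:
  assumes "complex_one_form M U \<xi>"
  shows "complex_one_form M U (\<lambda>q v. cnj (\<xi> q (conj_vec v)))"
  unfolding complex_one_form_def
proof (intro conjI ballI allI impI)
  fix V X assume "V \<subseteq> U" "smooth_field M V X"
  then show "smooth_fun M V (\<lambda>q. cnj (\<xi> q (conj_vec (X q))))"
    using assms smooth_field_conj_vec[of V X] unfolding complex_one_form_def
    by (intro smooth_fun_cnj) simp
qed (use assms in \<open>simp_all add: complex_one_form_def conj_vec_add conj_vec_cscale ctangent_conj_vec\<close>)

lemma complex_one_form_linear:
  assumes "complex_one_form M U \<xi>" "q \<in> U" "\<And>i. i \<in> I \<Longrightarrow> v i \<in> ctangent M q" "finite I"
  shows "\<xi> q (\<Sum>i\<in>I. c i *\<^sub>c v i) = (\<Sum>i\<in>I. c i * \<xi> q (v i))"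
  using assms(4,3)
proof (induction I rule: finite_induct)
  case empty
  \<comment> \<open>The empty sum: homogeneity with the scalar 0 gives the value at the zero
    vector.\<close>
  have "\<xi> q (0 *\<^sub>c 0) = 0 * \<xi> q 0"
    using assms(1,2) ctangent_zero unfolding complex_one_form_def by blast
  then show ?case by (simp only: cvs.scale_zero_left mult_zero_left sum.empty)
next
  case (insert i I)
  have "\<xi> q (c i *\<^sub>c v i + (\<Sum>i\<in>I. c i *\<^sub>c v i)) = \<xi> q (c i *\<^sub>c v i) + \<xi> q (\<Sum>i\<in>I. c i *\<^sub>c v i)"
    using assms(1,2) insert.prems ctangent_cscale ctangent_setsum[of I "\<lambda>i. c i *\<^sub>c v i" q]
    unfolding complex_one_form_def by simp
  moreover have "\<xi> q (c i *\<^sub>c v i) = c i * \<xi> q (v i)"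
    using assms(1,2) insert.prems unfolding complex_one_form_def by simp
  ultimately show ?case using insert by simp
qed

text \<open>Gaussian elimination on forms, one field at a time. Independence is assumed only at
  \<open>p\<close>; it yields a pivot that is nonzero at \<open>p\<close>, and shrinking the
  neighbourhood keeps it nonzero.\<close>

lemma dual_coframe:
  fixes N :: nat
  assumes U: "openin (mtop M) U" "p \<in> U"
    and X: "\<And>i. i < N \<Longrightarrow> smooth_field M U (X i)"
    and indep: "\<And>c i. (\<Sum>i<N. c i *\<^sub>c X i p) = 0 \<Longrightarrow> i < N \<Longrightarrow> c i = 0"
  shows "\<exists>W \<theta>. openin (mtop M) W \<and> p \<in> W \<and> W \<subseteq> U \<and> (\<forall>j<N. complex_one_form M W (\<theta> j)) \<and>
    (\<forall>q\<in>W. \<forall>i<N. \<forall>j<N. \<theta> j q (X i q) = (if i = j then 1 else 0))"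
  using X indep
proof (induction N)
  case 0
  then show ?case using U by auto
next
  case (Suc N)
  have ind: "c i = 0" if "(\<Sum>i<N. c i *\<^sub>c X i p) = 0" "i < N" for c i
    using Suc.prems(2)[of "\<lambda>i. if i < N then c i else 0" i] that by simp
  have "smooth_field M U (X i)" if "i < N" for i using Suc.prems(1) that by simp
  with ind have "\<exists>W \<theta>. openin (mtop M) W \<and> p \<in> W \<and> W \<subseteq> U \<and> (\<forall>j<N. complex_one_form M W (\<theta> j)) \<and>
    (\<forall>q\<in>W. \<forall>i<N. \<forall>j<N. \<theta> j q (X i q) = (if i = j then 1 else 0))"
    by (intro Suc.IH)
  then obtain W \<theta> where W: "openin (mtop M) W" "p \<in> W" "W \<subseteq> U"
    and \<theta>: "\<And>j. j < N \<Longrightarrow> complex_one_form M W (\<theta> j)"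
    and \<delta>: "\<And>q i j. q \<in> W \<Longrightarrow> i < N \<Longrightarrow> j < N \<Longrightarrow> \<theta> j q (X i q) = (if i = j then 1 else 0)"
    by blast
  \<comment> \<open>The part of \<open>X N p\<close> left after removing its components along the
    earlier fields. Independence at \<open>p\<close> makes it nonzero.\<close>
  define w where "w = X N p + (\<Sum>j<N. (- \<theta> j p (X N p)) *\<^sub>c X j p)"
  have "w \<noteq> 0"
  proof
    assume "w = 0"
    then have "(\<Sum>j<Suc N. (if j < N then - \<theta> j p (X N p) else 1) *\<^sub>c X j p) = 0"
      by (simp add: w_def add.commute)
    from Suc.prems(2)[OF this, of N] show False by simp
  qed
  then obtain f where f: "w f \<noteq> 0" by (auto simp: fun_eq_iff zero_fun_apply)
  have "w \<in> ctangent M p"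
    unfolding w_def using Suc.prems(1) U(2)
    by (intro ctangent_plus ctangent_setsum ctangent_cscale) (auto intro: smooth_field_ctangent[of U])
  \<comment> \<open>Vectors take the value 0 on functions that are not smooth at \<open>p\<close>,
    so a function detecting \<open>w\<close> is smooth there.\<close>
  then have "smooth_at M p f" using f ctangent_nonsmooth by blast
  then obtain U' where U': "p \<in> U'" "smooth_fun M U' f" by (auto simp: smooth_at_def)
  define W' where "W' = W \<inter> U'"
  have W': "openin (mtop M) W'" "p \<in> W'" "W' \<subseteq> W"
    using W U' smooth_fun_openin by (auto simp: W'_def)
  have f': "smooth_fun M W' f"
    using U'(2) W'(1) by (rule smooth_fun_subset) (simp add: W'_def)
  have X': "smooth_field M W' (X i)" if "i < Suc N" for i
    using smooth_field_subset[OF Suc.prems(1)[OF that] W'(1)] W'(3) W(3) by blast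
  have \<theta>': "complex_one_form M W' (\<theta> j)" if "j < N" for j
    using complex_one_form_subset[OF \<theta>[OF that] W'(1,3)] .
  \<comment> \<open>The differential of \<open>f\<close> corrected to annihilate the earlier fields.
    On \<open>X N\<close> at \<open>p\<close> it takes the value \<open>w f\<close>, the
    pivot.\<close>
  define \<omega> where "\<omega> q v = v f - (\<Sum>j<N. X j q f * \<theta> j q v)" for q v
  have \<omega>: "complex_one_form M W' \<omega>"
    unfolding \<omega>_def
  proof (rule complex_one_form_diff[OF complex_one_form_differential[OF f'] complex_one_form_sum[OF W'(1)]])
    fix j assume "j \<in> {..<N}"
    then have j: "j < N" "j < Suc N" by simp_all
    show "complex_one_form M W' (\<lambda>q v. X j q f * \<theta> j q v)"
      by (rule complex_one_form_scale[OF \<theta>'[OF j(1)] smooth_field_apply[OF X'[OF j(2)] f']])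
  qed
  define d where "d q = \<omega> q (X N q)" for q
  have d: "smooth_fun M W' d" unfolding d_def by (rule complex_one_form_apply[OF \<omega> X']) simp
  have "d p = w f"
    by (simp add: d_def \<omega>_def w_def plus_fun_apply sum_fun_apply cscale_def sum_negf mult.commute)
  then have dp: "d p \<noteq> 0" using f by simp
  obtain W'' where W'': "openin (mtop M) W''" "p \<in> W''" "W'' \<subseteq> W'" "\<And>q. q \<in> W'' \<Longrightarrow> d q \<noteq> 0"
    by (rule smooth_fun_nonzero_nbhd[OF d W'(2) dp]) (rule that)
  define \<theta>N where "\<theta>N q v = inverse (d q) * \<omega> q v" for q v
  have \<theta>N: "complex_one_form M W'' \<theta>N"
    unfolding \<theta>N_def
    by (rule complex_one_form_scale[OF complex_one_form_subset[OF \<omega> W''(1,3)]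
          smooth_fun_inverse[OF smooth_fun_subset[OF d W''(1,3)] W''(4)]])
  \<comment> \<open>The old forms may be nonzero on \<open>X N\<close>. Subtracting multiples of the
    new form cures this and leaves their values on the earlier fields intact, because the new form
    vanishes there.\<close>
  define \<theta>' where "\<theta>' j = (if j = N then \<theta>N else (\<lambda>q v. \<theta> j q v - \<theta> j q (X N q) * \<theta>N q v))" for j
  have "complex_one_form M W'' (\<theta>' j)" if "j < Suc N" for j
  proof (cases "j = N")
    case False
    with that have j: "j < N" by simp
    have "complex_one_form M W'' (\<theta> j)" using complex_one_form_subset[OF \<theta>'[OF j] W''(1,3)] .
    moreover have "smooth_field M W'' (X N)" using smooth_field_subset[OF X' W''(1,3)] by simp
    ultimately show ?thesis
      using False \<theta>N
      by (simp add: \<theta>'_def complex_one_form_diff complex_one_form_scale complex_one_form_apply)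
  qed (simp add: \<theta>'_def \<theta>N)
  moreover have "\<theta>' j q (X i q) = (if i = j then 1 else 0)"
    if q: "q \<in> W''" and ij: "i < Suc N" "j < Suc N" for q i j
  proof -
    have qW: "q \<in> W" using q W'' W' by auto
    have N1: "\<theta>N q (X N q) = 1" using W''(4)[OF q] by (simp add: \<theta>N_def d_def)
    have N0: "\<theta>N q (X i q) = 0" if "i < N" for i
    proof -
      have "(\<Sum>j<N. X j q f * \<theta> j q (X i q)) = (\<Sum>j<N. if j = i then X j q f else 0)"
        using \<delta>[OF qW that] by (intro sum.cong) auto
      then show ?thesis using that by (simp add: \<theta>N_def \<omega>_def)
    qed
    show ?thesis
      using ij N1 N0 \<delta>[OF qW] by (auto simp: \<theta>'_def less_Suc_eq)
  qed
  ultimately show ?case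
    using W''(1-3) W'(3) W(3) by (intro exI[of _ W''] exI[of _ \<theta>'] conjI allI ballI impI) (blast | simp)+
qed

section \<open>Derivations of functions with vanishing jets\<close>

text \<open>Hadamard's lemma pulled back from a coordinate ball. The coordinate increments
  \<open>y b\<close> are made complex valued, so that complex derivations act on them.\<close>

lemma Hadamard_chart:
  assumes V: "(V, \<phi>) \<in> atlas M" "p \<in> V" and f: "smooth_fun M U (f :: 'a \<Rightarrow> complex)" and p: "p \<in> U"
  obtains W y g where "openin (mtop M) W" "p \<in> W" "W \<subseteq> U"
    and "\<And>b. smooth_fun M W (y b)" "\<And>b. y b p = 0" "\<And>b. smooth_fun M W (g b)"
    and "\<And>q. q \<in> W \<Longrightarrow> f q = f p + (\<Sum>b\<in>(Basis :: 'e set). y b q * g b q)"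
    and "\<And>b. g b p = frechet_derivative (f \<circ> inv_into V \<phi>) (at (\<phi> p)) b"
    and "\<And>b v. frechet_derivative (\<lambda>x. frechet_derivative (f \<circ> inv_into V \<phi>) (at x) b) (at (\<phi> p)) v = 0 \<Longrightarrow>
       frechet_derivative (g b \<circ> inv_into V \<phi>) (at (\<phi> p)) v = 0"
proof -
  let ?F = "f \<circ> inv_into V \<phi>"
  have inv: "inv_into V \<phi> (\<phi> q) = q" if "q \<in> V" for q
    using chart_inj[OF V(1)] that by simp
  have "open (\<phi> ` (U \<inter> V))" using chart_open_image[OF V(1) smooth_fun_openin[OF f]] .
  then obtain r where r: "r > 0" "ball (\<phi> p) r \<subseteq> \<phi> ` (U \<inter> V)"
    using p V(2) open_contains_ball_eq by blast
  let ?B = "ball (\<phi> p) r"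
  obtain G where G: "\<And>b. smooth_on ?B (G b)"
    "\<And>x. x \<in> ?B \<Longrightarrow> ?F x = ?F (\<phi> p) + (\<Sum>b\<in>Basis. ((x - \<phi> p) \<bullet> b) *\<^sub>R G b x)"
    "\<And>b. G b (\<phi> p) = frechet_derivative ?F (at (\<phi> p)) b"
    "\<And>b v. frechet_derivative (\<lambda>x. frechet_derivative ?F (at x) b) (at (\<phi> p)) v = 0 \<Longrightarrow>
       frechet_derivative (G b) (at (\<phi> p)) v = 0"
    by (rule Hadamard[OF smooth_on_subset[OF smooth_funD[OF f V(1)] r(2)] r(1)]) (rule that)
  let ?W = "{q \<in> V. \<phi> q \<in> ?B}"
  have coord: "smooth_on ?B (\<lambda>x. complex_of_real ((x - \<phi> p) \<bullet> b))" for b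
  proof -
    have "Ck_on k ?B (\<lambda>x. x + (- \<phi> p))" for k
      by (intro Ck_on_add Ck_on_ident Ck_on_const open_ball)
    then show ?thesis
      unfolding smooth_on_def
      by (intro allI Ck_on_bounded_linear[OF open_ball bounded_linear_of_real]
          Ck_on_bounded_linear[OF open_ball bounded_linear_inner_left]) simp
  qed
  show thesis
  proof (rule that[of ?W "\<lambda>b q. complex_of_real ((\<phi> q - \<phi> p) \<bullet> b)" "\<lambda>b q. G b (\<phi> q)"])
    show "openin (mtop M) ?W" using chart_open_preimage[OF V(1) open_ball] .
    show "?W \<subseteq> U"
    proof safe
      fix q assume "q \<in> V" "\<phi> q \<in> ?B"
      then show "q \<in> U" using r(2) chart_inj[OF V(1)] by (auto simp: inj_on_eq_iff dest!: subsetD)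
    qed
    show "f q = f p + (\<Sum>b\<in>(Basis :: 'e set). complex_of_real ((\<phi> q - \<phi> p) \<bullet> b) * G b (\<phi> q))"
      if "q \<in> ?W" for q
      using G(2)[of "\<phi> q"] that V(2) by (simp add: inv scaleR_conv_of_real)
    show "smooth_fun M ?W (\<lambda>q. complex_of_real ((\<phi> q - \<phi> p) \<bullet> b))" "smooth_fun M ?W (\<lambda>q. G b (\<phi> q))" for b
      using smooth_fun_compose_chart[OF V(1) open_ball] coord G(1) by blast+
    fix b v assume *: "frechet_derivative (\<lambda>x. frechet_derivative ?F (at x) b) (at (\<phi> p)) v = 0"
    have "frechet_derivative ((\<lambda>q. G b (\<phi> q)) \<circ> inv_into V \<phi>) (at (\<phi> p)) = frechet_derivative (G b) (at (\<phi> p))"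
      by (rule frechet_derivative_cong_open[OF chart_open[OF V(1)]]) (auto simp: inv V(2))
    then show "frechet_derivative ((\<lambda>q. G b (\<phi> q)) \<circ> inv_into V \<phi>) (at (\<phi> p)) v = 0"
      using G(4)[OF *] by simp
  qed (use V r G(3) in auto)
qed

text \<open>In Hadamard's expansion every product \<open>y b * g b\<close> has both factors zero at
  \<open>p\<close>, so Leibniz kills it; the constant contributes nothing.\<close>

lemma ctangent_critical:
  assumes V: "(V, \<phi>) \<in> atlas M" "p \<in> V" and f: "smooth_at M p f"
    and d: "frechet_derivative (f \<circ> inv_into V \<phi>) (at (\<phi> p)) = (\<lambda>_. 0)" and v: "v \<in> ctangent M p"
  shows "v f = 0"
proof -
  obtain U where U: "smooth_fun M U f" "p \<in> U" using f by (auto simp: smooth_at_def)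
  obtain W y g where W: "openin (mtop M) W" "p \<in> W" "W \<subseteq> U"
    and y: "\<And>b. smooth_fun M W (y b)" "\<And>b. y b p = 0" and g: "\<And>b. smooth_fun M W (g b)"
    and eq: "\<And>q. q \<in> W \<Longrightarrow> f q = f p + (\<Sum>b\<in>(Basis :: 'e set). y b q * g b q)"
    and gp: "\<And>b. g b p = frechet_derivative (f \<circ> inv_into V \<phi>) (at (\<phi> p)) b"
    by (rule Hadamard_chart[OF V U]) (rule that)
  have p: "p \<in> topspace (mtop M)" using f by (rule smooth_at_topspace)
  have ya: "smooth_at M p (y b)" and ga: "smooth_at M p (g b)" for b
    using y(1) g W(2) by (blast intro: smooth_at_fun)+
  have "v f = v (\<lambda>q. f p + (\<Sum>b\<in>(Basis :: 'e set). y b q * g b q))"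
    by (rule ctangent_local[OF v smooth_fun_subset[OF U(1) W(1,3)] W(2) eq])
  also have "\<dots> = v (\<lambda>q. f p) + (\<Sum>b\<in>(Basis :: 'e set). v (\<lambda>q. y b q * g b q))"
    using p ya ga by (simp add: ctangent_add[OF v] ctangent_sum[OF v] smooth_at_const smooth_at_sum smooth_at_mult)
  also have "\<dots> = 0"
    by (simp add: ctangent_const[OF v] ctangent_mult[OF v ya ga] y(2) gp d)
  finally show ?thesis .
qed

text \<open>Leibniz at every point of \<open>W\<close> writes \<open>X f\<close> as the sum of
  \<open>y b * X (g b) + g b * X (y b)\<close>. Now apply \<open>v\<close> at \<open>p\<close>. The
  first product dies since \<open>y b\<close> and \<open>X (g b)\<close> vanish at \<open>p\<close>,
  the second since \<open>g b\<close> vanishes there together with \<open>v (g b)\<close>.\<close>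

lemma ctangent_field_critical:
  assumes V: "(V, \<phi>) \<in> atlas M" "p \<in> V" and f: "smooth_fun M U f" and p: "p \<in> U"
    and d: "frechet_derivative (f \<circ> inv_into V \<phi>) (at (\<phi> p)) = (\<lambda>_. 0)"
    and dd: "\<And>b. frechet_derivative (\<lambda>x. frechet_derivative (f \<circ> inv_into V \<phi>) (at x) b) (at (\<phi> p)) = (\<lambda>_. 0)"
    and X: "smooth_field M U X" and v: "v \<in> ctangent M p"
  shows "v (\<lambda>q. X q f) = 0"
proof -
  obtain W y g where W: "openin (mtop M) W" "p \<in> W" "W \<subseteq> U"
    and y: "\<And>b. smooth_fun M W (y b)" "\<And>b. y b p = 0" and g: "\<And>b. smooth_fun M W (g b)"
    and eq: "\<And>q. q \<in> W \<Longrightarrow> f q = f p + (\<Sum>b\<in>(Basis :: 'e set). y b q * g b q)"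
    and gp: "\<And>b. g b p = frechet_derivative (f \<circ> inv_into V \<phi>) (at (\<phi> p)) b"
    and dg: "\<And>b v. frechet_derivative (\<lambda>x. frechet_derivative (f \<circ> inv_into V \<phi>) (at x) b) (at (\<phi> p)) v = 0 \<Longrightarrow>
       frechet_derivative (g b \<circ> inv_into V \<phi>) (at (\<phi> p)) v = 0"
    by (rule Hadamard_chart[OF V f p]) (rule that)
  have top: "q \<in> topspace (mtop M)" if "q \<in> W" for q
    using W(1) that openin_subset by auto
  have fW: "smooth_fun M W f" using f W(1,3) by (rule smooth_fun_subset)
  have XW: "smooth_field M W X" using X W(1,3) by (rule smooth_field_subset)
  have ya: "smooth_at M q (y b)" and ga: "smooth_at M q (g b)" if "q \<in> W" for b q
    using y(1) g that by (blast intro: smooth_at_fun)+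
  \<comment> \<open>The second derivatives of \<open>f\<close> vanish, so \<open>g b\<close> is
    itself critical at \<open>p\<close> and the first order lemma applies to it.\<close>
  have g0: "u (g b) = 0" if "u \<in> ctangent M p" for u b
    by (rule ctangent_critical[OF V ga[OF W(2)] _ that]) (use dg dd in auto)
  have Xf: "X q f = (\<Sum>b\<in>(Basis :: 'e set). y b q * X q (g b) + g b q * X q (y b))" if q: "q \<in> W" for q
  proof -
    have v: "X q \<in> ctangent M q" using XW q by (rule smooth_field_ctangent)
    have "X q f = X q (\<lambda>q. f p + (\<Sum>b\<in>(Basis :: 'e set). y b q * g b q))"
      by (rule ctangent_local[OF v fW q eq])
    also have "\<dots> = X q (\<lambda>q. f p) + (\<Sum>b\<in>(Basis :: 'e set). X q (\<lambda>q. y b q * g b q))"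
      using top[OF q] ya[OF q] ga[OF q]
      by (simp add: ctangent_add[OF v] ctangent_sum[OF v] smooth_at_const smooth_at_sum smooth_at_mult)
    finally show ?thesis
      by (simp add: ctangent_const[OF v] ctangent_mult[OF v ya[OF q] ga[OF q]])
  qed
  have Xy: "smooth_at M p (\<lambda>q. X q (y b))" and Xg: "smooth_at M p (\<lambda>q. X q (g b))" for b
    using smooth_field_apply[OF XW] y(1) g W(2) by (blast intro: smooth_at_fun)+
  have "v (\<lambda>q. X q f) = v (\<lambda>q. \<Sum>b\<in>(Basis :: 'e set). y b q * X q (g b) + g b q * X q (y b))"
    by (rule ctangent_local[OF v smooth_field_apply[OF XW fW] W(2) Xf])
  also have "\<dots> = (\<Sum>b\<in>(Basis :: 'e set). v (\<lambda>q. y b q * X q (g b)) + v (\<lambda>q. g b q * X q (y b)))"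
    using top[OF W(2)] ya[OF W(2)] ga[OF W(2)] Xy Xg
    by (simp add: ctangent_add[OF v] ctangent_sum[OF v] smooth_at_add smooth_at_mult)
  also have "\<dots> = 0"
    using smooth_field_ctangent[OF XW W(2)]
    by (simp add: ctangent_mult[OF v ya[OF W(2)] Xg] ctangent_mult[OF v ga[OF W(2)] Xy]
        y(2) gp d g0 v)
  finally show ?thesis .
qed

end

section \<open>The correction form\<close>

lemma sum_lessThan_add:
  fixes f :: "nat \<Rightarrow> 'b::comm_monoid_add"
  shows "(\<Sum>i<m + n. f i) = (\<Sum>i<m. f i) + (\<Sum>i<n. f (m + i))"
  by (induction n) (auto simp: add.assoc)

text \<open>Independence is given for the set of frame vectors, while coefficients are indexed;
  injectivity passes between the two.\<close>

lemma cindependent_frame: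
  fixes L :: "nat \<Rightarrow> 'x \<Rightarrow> complex"
  assumes "inj_on L {..<m}" "cindependent (L ` {..<m})" "(\<Sum>k<m. c k *\<^sub>c L k) = 0" "k < m"
  shows "c k = 0"
proof -
  have "(\<Sum>v\<in>L ` {..<m}. c (inv_into {..<m} L v) *\<^sub>c v) = (\<Sum>k<m. c k *\<^sub>c L k)"
    using assms(1) by (simp add: sum.reindex)
  then have "(\<Sum>v\<in>L ` {..<m}. c (inv_into {..<m} L v) *\<^sub>c v) = 0" using assms(3) by simp
  from cvs.independentD[OF assms(2)[unfolded cindependent_def] _ _ this, of "L k"]
  show ?thesis using assms(1,4) by simp
qed

lemma cspan_frame:
  fixes L :: "nat \<Rightarrow> 'x \<Rightarrow> complex"
  assumes "inj_on L {..<m}" "Z \<in> cspan (L ` {..<m})"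
  obtains c where "Z = (\<Sum>k<m. c k *\<^sub>c L k)"
proof -
  obtain u where "Z = (\<Sum>v\<in>L ` {..<m}. u v *\<^sub>c v)"
    using assms(2) by (auto simp: cvs.span_finite)
  then show thesis using assms(1) that[of "u \<circ> L"] by (simp add: sum.reindex)
qed

lemma cspan_frame_sum: "(\<Sum>k<m. c k *\<^sub>c L k) \<in> cspan (L ` {..<m})"
  by (intro cvs.span_sum cvs.span_scale cvs.span_base) auto

text \<open>A relation has the form \<open>A + conj_vec B = 0\<close> with \<open>A\<close> and
  \<open>B\<close> in the span, so \<open>A\<close> lies in the span and in its conjugate. Hence
  \<open>A\<close> and \<open>B\<close> vanish, and the frame itself is independent.\<close>

lemma frame_conj_independent:
  fixes m :: nat
  assumes inj: "inj_on L {..<m}" and ind: "cindependent (L ` {..<m})"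
    and tr: "cspan (L ` {..<m}) \<inter> conj_vec ` cspan (L ` {..<m}) = {0}"
    and z: "(\<Sum>i<m + m. c i *\<^sub>c (if i < m then L i else conj_vec (L (i - m)))) = 0" and i: "i < m + m"
  shows "c i = 0"
proof -
  \<comment> \<open>\<open>conj_vec\<close> is antilinear, so the coefficients of \<open>?B\<close>
    are conjugated in advance.\<close>
  let ?A = "\<Sum>k<m. c k *\<^sub>c L k" and ?B = "\<Sum>k<m. cnj (c (m + k)) *\<^sub>c L k"
  have "(\<Sum>i<m + m. c i *\<^sub>c (if i < m then L i else conj_vec (L (i - m)))) =
      ?A + (\<Sum>k<m. c (m + k) *\<^sub>c conj_vec (L k))"
    by (simp add: sum_lessThan_add)
  then have AB: "?A + conj_vec ?B = 0"
    using z by (simp add: conj_vec_sum conj_vec_cscale)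
  have "?A = conj_vec (- ?B)"
    using AB by (simp add: fun_eq_iff conj_vec_def plus_fun_apply zero_fun_apply eq_neg_iff_add_eq_0)
  moreover have "- ?B \<in> cspan (L ` {..<m})"
    by (intro cvs.span_neg cspan_frame_sum)
  ultimately have "?A \<in> cspan (L ` {..<m}) \<inter> conj_vec ` cspan (L ` {..<m})"
    using cspan_frame_sum by blast
  then have A: "?A = 0" using tr by blast
  then have "conj_vec ?B = 0" using AB by simp
  then have B: "?B = 0" by (metis conj_vec_conj_vec conj_vec_zero)
  show ?thesis
  proof (cases "i < m")
    case True
    then show ?thesis using cindependent_frame[OF inj ind A] by blast
  next
    case False
    then have "cnj (c (m + (i - m))) = 0" using cindependent_frame[OF inj ind B, of "i - m"] i by simp
    then show ?thesis using False by simp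
  qed
qed

context smooth_mfd
begin

section \<open>The flat correction and its effect on the exterior derivative\<close>

text \<open>For each pair of extensions \<open>X\<close>, \<open>Y\<close> the three terms
  contributed by \<eta> vanish, so a number meets the defining condition for the sum exactly when it
  meets the one for \<xi>. The vanishing of \<open>\<eta> p\<close> on every \<open>v\<close>
  applies to the bracket directly.\<close>

lemma ext_deriv_add_flat:
  assumes \<xi>: "complex_one_form M U \<xi>" and p: "p \<in> U"
    and \<eta>: "complex_one_form M U \<eta>" "\<And>v. \<eta> p v = 0"
      "\<And>W Y v. p \<in> W \<Longrightarrow> smooth_field M W Y \<Longrightarrow> v \<in> ctangent M p \<Longrightarrow> v (\<lambda>q. \<eta> q (Y q)) = 0"
  shows "ext_deriv M (\<lambda>q v. \<xi> q v + \<eta> q v) p = ext_deriv M \<xi> p"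
proof -
  \<comment> \<open>Derivations are additive only on functions smooth at the point. Both summands
    are smooth on the common domain \<open>U \<inter> W\<close>.\<close>
  have app: "X p (\<lambda>q. \<xi> q (Y q) + \<eta> q (Y q)) = X p (\<lambda>q. \<xi> q (Y q))"
    if "p \<in> W" "smooth_field M W X" "smooth_field M W Y" for W X Y
  proof -
    have X: "X p \<in> ctangent M p" using smooth_field_ctangent that by blast
    have W: "openin (mtop M) (U \<inter> W)"
      using complex_one_form_openin[OF \<xi>] smooth_field_openin[OF that(2)] by blast
    have Y: "smooth_field M (U \<inter> W) Y" using smooth_field_subset[OF that(3) W] by blast
    have "smooth_at M p (\<lambda>q. \<zeta> q (Y q))" if "complex_one_form M U \<zeta>" for \<zeta>
      using smooth_at_fun[OF complex_one_form_apply[OF complex_one_form_subset[OF that W] Y]] p \<open>p \<in> W\<close>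
      by blast
    then show ?thesis
      using \<xi> \<eta>(1) \<eta>(3)[OF that(1,3) X] by (simp add: ctangent_add[OF X])
  qed
  have "(\<forall>W X Y. p \<in> W \<longrightarrow> smooth_field M W X \<longrightarrow> smooth_field M W Y \<longrightarrow> X p = v \<longrightarrow> Y p = w \<longrightarrow>
      c = X p (\<lambda>q. \<xi> q (Y q) + \<eta> q (Y q)) - Y p (\<lambda>q. \<xi> q (X q) + \<eta> q (X q))
        - (\<xi> p (lie_bracket M X Y p) + \<eta> p (lie_bracket M X Y p))) \<longleftrightarrow>
    (\<forall>W X Y. p \<in> W \<longrightarrow> smooth_field M W X \<longrightarrow> smooth_field M W Y \<longrightarrow> X p = v \<longrightarrow> Y p = w \<longrightarrow>
      c = X p (\<lambda>q. \<xi> q (Y q)) - Y p (\<lambda>q. \<xi> q (X q)) - \<xi> p (lie_bracket M X Y p))" for c v w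
  proof (intro iff_allI imp_cong refl)
    fix W X Y assume "p \<in> W" "smooth_field M W X" "smooth_field M W Y"
    then show "(c = X p (\<lambda>q. \<xi> q (Y q) + \<eta> q (Y q)) - Y p (\<lambda>q. \<xi> q (X q) + \<eta> q (X q))
        - (\<xi> p (lie_bracket M X Y p) + \<eta> p (lie_bracket M X Y p))) \<longleftrightarrow>
      (c = X p (\<lambda>q. \<xi> q (Y q)) - Y p (\<lambda>q. \<xi> q (X q)) - \<xi> p (lie_bracket M X Y p))"
      using app[of W X Y] app[of W Y X] by (simp add: \<eta>(2))
  qed
  then show ?thesis by (simp add: ext_deriv_def fun_eq_iff)
qed

text \<open>A second order perturbation of \<open>\<rho>\<close> changes \<open>\<xi>\<close> by a form \<open>\<eta>\<close> whose 1-jet vanishes at \<open>p\<close>.\<close>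

lemma flat_correction:
  assumes CR: "almost_CR M T" and \<Omega>: "p \<in> \<Omega>" "smooth_fun M \<Omega> \<rho>1" "smooth_fun M \<Omega> \<rho>2"
    and agree: "agree_to_second_order M p \<rho>1 \<rho>2"
  obtains W \<eta> where "p \<in> W" "real_one_form M W \<eta>"
    "\<And>q Z. q \<in> W \<Longrightarrow> Z \<in> T q \<Longrightarrow> differential \<rho>1 q Z - differential \<rho>2 q Z + \<i> * \<eta> q Z = 0"
    "\<And>v. \<eta> p v = 0"
    "\<And>U Y v. p \<in> U \<Longrightarrow> smooth_field M U Y \<Longrightarrow> v \<in> ctangent M p \<Longrightarrow> v (\<lambda>q. \<eta> q (Y q)) = 0"
proof -
  have op\<Omega>: "openin (mtop M) \<Omega>" using \<Omega>(2) by (rule smooth_fun_openin)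
  have ptop: "p \<in> topspace (mtop M)" using \<Omega>(1) openin_subset[OF op\<Omega>] by blast
  obtain V \<phi> where V: "(V, \<phi>) \<in> atlas M" "p \<in> V"
    and D1: "frechet_derivative (\<rho>1 \<circ> inv_into V \<phi>) (at (\<phi> p)) = frechet_derivative (\<rho>2 \<circ> inv_into V \<phi>) (at (\<phi> p))"
    and D2: "\<And>v. frechet_derivative (\<lambda>y. frechet_derivative (\<rho>1 \<circ> inv_into V \<phi>) (at y) v) (at (\<phi> p)) =
      frechet_derivative (\<lambda>y. frechet_derivative (\<rho>2 \<circ> inv_into V \<phi>) (at y) v) (at (\<phi> p))"
    using agree by (auto simp: agree_to_second_order_def Let_def)
  define \<sigma> where "\<sigma> q = complex_of_real (\<rho>1 q - \<rho>2 q)" for q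
  have \<sigma>: "smooth_fun M \<Omega> \<sigma>"
    unfolding \<sigma>_def by (intro smooth_fun_bounded_linear[OF bounded_linear_of_real] smooth_fun_diff \<Omega>)
  let ?F1 = "\<rho>1 \<circ> inv_into V \<phi>" and ?F2 = "\<rho>2 \<circ> inv_into V \<phi>" and ?S = "\<sigma> \<circ> inv_into V \<phi>"
  let ?O = "\<phi> ` (\<Omega> \<inter> V)"
  have O: "open ?O" "\<phi> p \<in> ?O" using chart_open_image[OF V(1) op\<Omega>] V(2) \<Omega>(1) by auto
  have F: "smooth_on ?O ?F1" "smooth_on ?O ?F2" using smooth_funD[OF _ V(1)] \<Omega> by blast+
  have diff: "frechet_derivative (\<lambda>x. complex_of_real (f x - g x)) (at x) =
      (\<lambda>v. complex_of_real (frechet_derivative f (at x) v - frechet_derivative g (at x) v))"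
    if "f differentiable (at x)" "g differentiable (at x)" for f g :: "'e \<Rightarrow> real" and x
    using that by (intro frechet_derivative_at[symmetric] bounded_linear.has_derivative[OF bounded_linear_of_real]
        has_derivative_diff) (auto simp: frechet_derivative_works)
  have S: "?S = (\<lambda>x. complex_of_real (?F1 x - ?F2 x))" by (simp add: \<sigma>_def fun_eq_iff)
  have dS: "frechet_derivative ?S (at x) =
      (\<lambda>v. complex_of_real (frechet_derivative ?F1 (at x) v - frechet_derivative ?F2 (at x) v))" if "x \<in> ?O" for x
    unfolding S using that F by (intro diff smooth_on_differentiable)
  have dS0: "frechet_derivative ?S (at (\<phi> p)) = (\<lambda>_. 0)"
    using dS[OF O(2)] D1 by simp
  have ddS0: "frechet_derivative (\<lambda>x. frechet_derivative ?S (at x) b) (at (\<phi> p)) = (\<lambda>_. 0)" for b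
  proof -
    \<comment> \<open>A second derivative depends on the first derivatives near the point, so these
      are replaced on the whole open set \<open>?O\<close>.\<close>
    have "frechet_derivative (\<lambda>x. frechet_derivative ?S (at x) b) (at (\<phi> p)) =
        frechet_derivative (\<lambda>x. complex_of_real (frechet_derivative ?F1 (at x) b - frechet_derivative ?F2 (at x) b)) (at (\<phi> p))"
      by (rule frechet_derivative_cong_open[OF O]) (use dS in simp)
    also have "\<dots> = (\<lambda>_. 0)"
      using smooth_on_differentiable[OF smooth_on_frechet[OF F(1)] O(2), of b]
        smooth_on_differentiable[OF smooth_on_frechet[OF F(2)] O(2), of b]
      by (subst diff) (simp_all add: D2)
    finally show ?thesis .
  qed
  obtain m :: nat and U L where U: "p \<in> U" "openin (mtop M) U" and L: "\<And>k. k < m \<Longrightarrow> smooth_field M U (L k)"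
    and fr: "\<And>q. q \<in> U \<Longrightarrow> inj_on (\<lambda>k. L k q) {..<m} \<and> cindependent ((\<lambda>k. L k q) ` {..<m}) \<and>
               T q = cspan ((\<lambda>k. L k q) ` {..<m})"
  proof -
    from CR obtain m :: nat where "\<forall>p\<in>topspace (mtop M). \<exists>U L. p \<in> U \<and> (\<forall>k<m. smooth_field M U (L k)) \<and>
        openin (mtop M) U \<and>
        (\<forall>q\<in>U. inj_on (\<lambda>k. L k q) {..<m} \<and> cindependent ((\<lambda>k. L k q) ` {..<m}) \<and>
               T q = cspan ((\<lambda>k. L k q) ` {..<m}))"
      unfolding almost_CR_def by (elim conjE exE)
    from bspec[OF this ptop] obtain U L where "p \<in> U" "\<forall>k<m. smooth_field M U (L k)" "openin (mtop M) U"
        "\<forall>q\<in>U. inj_on (\<lambda>k. L k q) {..<m} \<and> cindependent ((\<lambda>k. L k q) ` {..<m}) \<and>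
               T q = cspan ((\<lambda>k. L k q) ` {..<m})"
      by (elim exE conjE) (rule that)
    then show thesis by (intro that[where U = U and m = m and L = L]) simp_all
  qed
  \<comment> \<open>The conjugates occupy the indices from \<open>m\<close> on. Only the first
    \<open>m\<close> dual forms will be used; duality to the enlarged family makes them vanish on
    the conjugate frame.\<close>
  let ?X = "\<lambda>i q. if i < m then L i q else conj_vec (L (i - m) q)"
  define U' where "U' = U \<inter> \<Omega>"
  have U': "openin (mtop M) U'" "p \<in> U'" "U' \<subseteq> U" "U' \<subseteq> \<Omega>" using U \<Omega>(1) op\<Omega> by (auto simp: U'_def)
  have X: "smooth_field M U' (?X i)" if "i < m + m" for i
    using smooth_field_subset[OF L U'(1,3)] smooth_field_conj_vec that by (cases "i < m") auto
  have tr: "T p \<inter> conj_vec ` T p = {0}" using CR ptop by (simp add: almost_CR_def)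
  have "\<exists>W \<theta>. openin (mtop M) W \<and> p \<in> W \<and> W \<subseteq> U' \<and> (\<forall>j<m + m. complex_one_form M W (\<theta> j)) \<and>
    (\<forall>q\<in>W. \<forall>i<m + m. \<forall>j<m + m. \<theta> j q (?X i q) = (if i = j then 1 else 0))"
  proof (rule dual_coframe[OF U'(1,2) X])
    fix c i assume "(\<Sum>i<m + m. c i *\<^sub>c ?X i p) = 0" "i < m + m"
    then show "c i = 0"
      using fr[OF U(1)] tr by (intro frame_conj_independent[of "\<lambda>k. L k p" m c i]) auto
  qed
  then obtain W \<theta> where W: "openin (mtop M) W" "p \<in> W" "W \<subseteq> U'"
    and \<theta>0: "\<forall>j<m + m. complex_one_form M W (\<theta> j)"
    and \<delta>0: "\<forall>q\<in>W. \<forall>i<m + m. \<forall>j<m + m. \<theta> j q (?X i q) = (if i = j then 1 else 0)"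
    by (elim exE conjE) (rule that)
  have \<theta>: "complex_one_form M W (\<theta> k)" if "k < m" for k using \<theta>0 that by simp
  have \<delta>: "\<theta> k q (L l q) = (if l = k then 1 else 0)" if "q \<in> W" "k < m" "l < m" for k l q
    using \<delta>0[rule_format, of q l k] that by simp
  have \<delta>': "\<theta> k q (conj_vec (L l q)) = 0" if "q \<in> W" "k < m" "l < m" for k l q
    using \<delta>0[rule_format, of q "m + l" k] that by simp
  have LW: "smooth_field M W (L k)" if "k < m" for k
    using smooth_field_subset[OF L[OF that] W(1)] W(3) U'(3) by blast
  have \<sigma>W: "smooth_fun M W \<sigma>" using smooth_fun_subset[OF \<sigma> W(1)] W(3) U'(4) by blast
  \<comment> \<open>The factor \<open>\<i>\<close> solves
    \<open>L k q \<sigma> + \<i> * g k q = 0\<close>, the equation that \<eta> has to satisfy on the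
    frame.\<close>
  define g where "g k q = \<i> * L k q \<sigma>" for k q
  have Lg: "smooth_fun M W (\<lambda>q. L k q \<sigma>)" if "k < m" for k
    using smooth_field_apply[OF LW[OF that] \<sigma>W] .
  have g: "smooth_fun M W (g k)" if "k < m" for k
    unfolding g_def using smooth_fun_const[OF W(1)] Lg[OF that] by (intro smooth_fun_mult)
  have \<sigma>p: "smooth_at M p \<sigma>" using smooth_at_fun[OF \<sigma>W W(2)] .
  have gp: "g k p = 0" if "k < m" for k
    using ctangent_critical[OF V \<sigma>p dS0 smooth_field_ctangent[OF LW[OF that] W(2)]] by (simp add: g_def)
  have dg: "v (g k) = 0" if "k < m" "v \<in> ctangent M p" for v k
    using ctangent_field_critical[OF V \<sigma>W W(2) dS0 ddS0 LW[OF that(1)] that(2)]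
      ctangent_cmult[OF that(2) smooth_at_fun[OF Lg[OF that(1)] W(2)], of \<i>]
    by (simp add: g_def[abs_def])
  define \<omega> where "\<omega> q v = (\<Sum>k<m. g k q * \<theta> k q v)" for q v
  have \<omega>: "complex_one_form M W \<omega>"
    unfolding \<omega>_def by (intro complex_one_form_sum complex_one_form_scale W(1) \<theta> g) auto
  \<comment> \<open>The second summand makes the form real. On a frame vector it evaluates \<omega>
    at the conjugate vector, where \<omega> vanishes, so the equation on the bundle is
    undisturbed.\<close>
  define \<eta> where "\<eta> q v = \<omega> q v + cnj (\<omega> q (conj_vec v))" for q v
  have \<eta>: "complex_one_form M W \<eta>"
    unfolding \<eta>_def by (intro complex_one_form_add complex_one_form_conj \<omega>)
  have \<omega>0: "v (\<lambda>q. \<omega> q (Y q)) = 0" "smooth_at M p (\<lambda>q. \<omega> q (Y q))"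
    if "p \<in> B" "smooth_field M B Y" "v \<in> ctangent M p" for B Y v
  proof -
    have BW: "openin (mtop M) (B \<inter> W)" using smooth_field_openin[OF that(2)] W(1) by blast
    have YB: "smooth_field M (B \<inter> W) Y" using smooth_field_subset[OF that(2) BW] by blast
    have pB: "p \<in> B \<inter> W" using that W by blast
    have t: "smooth_at M p (\<lambda>q. \<theta> k q (Y q))" if "k < m" for k
      using smooth_at_fun[OF complex_one_form_apply[OF complex_one_form_subset[OF \<theta>[OF that] BW] YB] pB]
      by blast
    have ga: "smooth_at M p (g k)" if "k < m" for k using smooth_at_fun[OF g[OF that] W(2)] .
    have "v (\<lambda>q. \<omega> q (Y q)) = (\<Sum>k<m. v (\<lambda>q. g k q * \<theta> k q (Y q)))"
      unfolding \<omega>_def using t ga by (intro ctangent_sum[OF that(3) ptop] smooth_at_mult) auto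
    also have "\<dots> = 0"
      using t ga gp dg that(3) by (intro sum.neutral) (auto simp: ctangent_mult[OF that(3)])
    finally show "v (\<lambda>q. \<omega> q (Y q)) = 0" .
    show "smooth_at M p (\<lambda>q. \<omega> q (Y q))"
      unfolding \<omega>_def using t ga by (intro smooth_at_sum ptop smooth_at_mult) auto
  qed
  show thesis
  proof (rule that[OF W(2)])
    show "real_one_form M W \<eta>"
      unfolding real_one_form_iff
    proof (intro conjI \<eta> ballI)
      fix q v assume "v \<in> tangent M q"
      then have "cnj (\<eta> q v) = \<eta> q v" by (simp add: \<eta>_def tangent_def add.commute)
      then show "\<eta> q v \<in> \<real>" by (simp add: Reals_cnj_iff)
    qed
    show "\<eta> p v = 0" for v by (simp add: \<eta>_def \<omega>_def gp)
    show "v (\<lambda>q. \<eta> q (Y q)) = 0" if B: "p \<in> B" "smooth_field M B Y" and v: "v \<in> ctangent M p" for B Y v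
    proof -
      note cB = B(1) smooth_field_conj_vec[OF B(2)]
      \<comment> \<open>Moving the conjugation from the function to the vector reduces the second
        summand to the vanishing already shown for \<omega>, applied to the conjugate field and
        \<open>conj_vec v\<close>.\<close>
      have "v (\<lambda>q. cnj (\<omega> q (conj_vec (Y q)))) = cnj (conj_vec v (\<lambda>q. \<omega> q (conj_vec (Y q))))"
        by (simp add: conj_vec_def)
      then have "v (\<lambda>q. cnj (\<omega> q (conj_vec (Y q)))) = 0"
        using \<omega>0(1)[OF cB ctangent_conj_vec[OF v]] by simp
      then show ?thesis
        unfolding \<eta>_def
        using ctangent_add[OF v \<omega>0(2)[OF B v] smooth_at_cnj[OF \<omega>0(2)[OF cB v]]] \<omega>0(1)[OF B v] by simp
    qed
    fix q Z assume q: "q \<in> W" and "Z \<in> T q"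
    then have qU: "q \<in> U" "q \<in> \<Omega>" using W(3) U'(3,4) by auto
    have "inj_on (\<lambda>k. L k q) {..<m}" "Z \<in> cspan ((\<lambda>k. L k q) ` {..<m})"
      using \<open>Z \<in> T q\<close> fr[OF qU(1)] by auto
    then obtain c where Z: "Z = (\<Sum>k<m. c k *\<^sub>c L k q)" by (rule cspan_frame)
    have Lq: "L k q \<in> ctangent M q" if "k < m" for k using smooth_field_ctangent[OF LW[OF that] q] .
    have \<eta>L: "\<eta> q (L l q) = \<i> * L l q \<sigma>" if "l < m" for l
    proof -
      have "\<omega> q (L l q) = (\<Sum>k<m. if l = k then g k q else 0)"
        unfolding \<omega>_def using \<delta>[OF q _ that] by (intro sum.cong) auto
      moreover have "\<omega> q (conj_vec (L l q)) = 0"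
        unfolding \<omega>_def using \<delta>'[OF q _ that] by (intro sum.neutral) auto
      ultimately show ?thesis using that by (simp add: \<eta>_def g_def)
    qed
    have "\<eta> q Z = (\<Sum>k<m. c k * \<eta> q (L k q))"
      unfolding Z using Lq by (intro complex_one_form_linear[OF \<eta> q]) auto
    also have "\<dots> = \<i> * Z \<sigma>"
      by (simp add: \<eta>L Z sum_fun_apply cscale_def sum_distrib_left algebra_simps)
    finally have \<eta>Z: "\<eta> q Z = \<i> * Z \<sigma>" .
    have ZT: "Z \<in> ctangent M q" unfolding Z using Lq by (intro ctangent_setsum ctangent_cscale) auto
    have sm: "smooth_at M q (\<lambda>x. complex_of_real (\<rho> x))" if "smooth_fun M \<Omega> \<rho>" for \<rho>
      using smooth_at_fun[OF smooth_fun_bounded_linear[OF bounded_linear_of_real that] qU(2)] .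
    have "smooth_at M q \<sigma>" using smooth_at_fun[OF \<sigma>W q] .
    \<comment> \<open>Additivity yields the difference of differentials once \<open>\<rho>1\<close>
      is read as \<open>\<sigma> + \<rho>2\<close>.\<close>
    then have "Z (\<lambda>x. \<sigma> x + complex_of_real (\<rho>2 x)) = Z \<sigma> + Z (\<lambda>x. complex_of_real (\<rho>2 x))"
      using ctangent_add[OF ZT] sm[OF \<Omega>(3)] by blast
    then have "Z \<sigma> = differential \<rho>1 q Z - differential \<rho>2 q Z"
      by (simp add: \<sigma>_def differential_def)
    then show "differential \<rho>1 q Z - differential \<rho>2 q Z + \<i> * \<eta> q Z = 0"
      by (simp add: \<eta>Z)
  qed
qed

end

section \<open>Comparison of the two values\<close>

theorem corollary5p8:
  fixes M :: "('a, 'e::euclidean_space) mfd"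
    and T01 :: "'a \<Rightarrow> 'a ctvec set"
    and \<Omega> :: "'a set" and p0 :: 'a
    and \<rho>1 \<rho>2 :: "'a \<Rightarrow> real"
  assumes "almost_CR M T01"
    and "openin (mtop M) \<Omega>" and "p0 \<in> \<Omega>"
    and "smooth_fun M \<Omega> \<rho>1" and "smooth_fun M \<Omega> \<rho>2"
    and "agree_to_second_order M p0 \<rho>1 \<rho>2"
  shows "\<forall>\<tau>0 \<in> ker_levi M T01 p0. ddc M T01 \<rho>1 p0 \<tau>0 = ddc M T01 \<rho>2 p0 \<tau>0"
proof -
  interpret smooth_mfd M using assms(1) by unfold_locales (simp add: almost_CR_def)
  \<comment> \<open>The condition inside the definite description of \<open>ddc\<close>, with the
    candidate value \<open>c\<close> free.\<close>
  define P where "P \<rho> \<tau> c \<longleftrightarrow> (\<forall>U \<xi> (n::nat) Z.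
     p0 \<in> U \<longrightarrow> dc_form M T01 \<rho> U \<xi> \<longrightarrow> (\<forall>j<n. Z j \<in> T01 p0) \<longrightarrow>
     \<tau> = (\<Sum>j<n. Z j \<otimes>\<^sub>t conj_vec (Z j)) \<longrightarrow>
     c = \<i> / 2 * (\<Sum>j<n. ext_deriv M \<xi> p0 (Z j) (conj_vec (Z j))))" for \<rho> \<tau> c
  \<comment> \<open>The forms move against the implication: a form \<xi> admissible for \<rho>
    becomes one admissible for \<open>\<rho>'\<close> by adding \<eta>, and there the hypothesis on
    \<open>c\<close> applies.\<close>
  have imp: "P \<rho> \<tau> c"
    if \<rho>: "smooth_fun M \<Omega> \<rho>" "smooth_fun M \<Omega> \<rho>'" "agree_to_second_order M p0 \<rho>' \<rho>"
      and P: "P \<rho>' \<tau> c" for \<rho> \<rho>' \<tau> c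
    unfolding P_def
  proof (intro allI impI)
    fix U \<xi> Z and n :: nat
    assume U: "p0 \<in> U" and \<xi>: "dc_form M T01 \<rho> U \<xi>" and Z: "\<forall>j<n. Z j \<in> T01 p0"
      and \<tau>: "\<tau> = (\<Sum>j<n. Z j \<otimes>\<^sub>t conj_vec (Z j))"
    obtain W \<eta> where W: "p0 \<in> W" "real_one_form M W \<eta>"
      and \<eta>T: "\<And>q Z. q \<in> W \<Longrightarrow> Z \<in> T01 q \<Longrightarrow> differential \<rho>' q Z - differential \<rho> q Z + \<i> * \<eta> q Z = 0"
      and \<eta>0: "\<And>v. \<eta> p0 v = 0"
        "\<And>U Y v. p0 \<in> U \<Longrightarrow> smooth_field M U Y \<Longrightarrow> v \<in> ctangent M p0 \<Longrightarrow> v (\<lambda>q. \<eta> q (Y q)) = 0"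
      by (rule flat_correction[OF assms(1,3) \<rho>(2,1,3)]) (rule that)
    have \<xi>': "complex_one_form M U \<xi>" "\<And>q v. q \<in> U \<Longrightarrow> v \<in> tangent M q \<Longrightarrow> \<xi> q v \<in> \<real>"
      and \<xi>T: "\<And>q Z. q \<in> U \<Longrightarrow> Z \<in> T01 q \<Longrightarrow> differential \<rho> q Z + \<i> * \<xi> q Z = 0"
      using \<xi> by (auto simp: dc_form_def real_one_form_iff)
    have \<eta>': "complex_one_form M W \<eta>" "\<And>q v. q \<in> W \<Longrightarrow> v \<in> tangent M q \<Longrightarrow> \<eta> q v \<in> \<real>"
      using W(2) by (auto simp: real_one_form_iff)
    have UW: "openin (mtop M) (U \<inter> W)"
      using complex_one_form_openin \<xi>'(1) \<eta>'(1) by blast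
    have cf: "complex_one_form M (U \<inter> W) \<xi>" "complex_one_form M (U \<inter> W) \<eta>"
      using complex_one_form_subset[OF \<xi>'(1) UW] complex_one_form_subset[OF \<eta>'(1) UW] by blast+
    let ?\<xi> = "\<lambda>q v. \<xi> q v + \<eta> q v"
    have "dc_form M T01 \<rho>' (U \<inter> W) ?\<xi>"
      unfolding dc_form_def real_one_form_iff
    proof (intro conjI ballI complex_one_form_add cf)
      fix q v assume "q \<in> U \<inter> W" "v \<in> tangent M q"
      then show "\<xi> q v + \<eta> q v \<in> \<real>" using \<xi>'(2) \<eta>'(2) by (intro Reals_add) auto
    next
      fix q Z assume q: "q \<in> U \<inter> W" and "Z \<in> T01 q"
      then have "differential \<rho> q Z + \<i> * \<xi> q Z = 0"
        "differential \<rho>' q Z - differential \<rho> q Z + \<i> * \<eta> q Z = 0"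
        using \<xi>T \<eta>T by blast+
      moreover have "differential \<rho>' q Z + \<i> * (\<xi> q Z + \<eta> q Z) =
          (differential \<rho> q Z + \<i> * \<xi> q Z) + (differential \<rho>' q Z - differential \<rho> q Z + \<i> * \<eta> q Z)"
        by (simp add: algebra_simps)
      ultimately show "differential \<rho>' q Z + \<i> * (\<xi> q Z + \<eta> q Z) = 0" by simp
    qed
    then have "c = \<i> / 2 * (\<Sum>j<n. ext_deriv M ?\<xi> p0 (Z j) (conj_vec (Z j)))"
      using P U W(1) Z \<tau> unfolding P_def by blast
    also have "ext_deriv M ?\<xi> p0 = ext_deriv M \<xi> p0"
    proof (rule ext_deriv_add_flat[OF cf(1) _ cf(2)])
      show "p0 \<in> U \<inter> W" using U W(1) by simp
    qed (fact \<eta>0)+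
    finally show "c = \<i> / 2 * (\<Sum>j<n. ext_deriv M \<xi> p0 (Z j) (conj_vec (Z j)))" .
  qed
  have sym: "agree_to_second_order M p0 \<rho>2 \<rho>1"
  proof -
    obtain V\<phi> where "V\<phi> \<in> atlas M" "case V\<phi> of (V, \<phi>) \<Rightarrow> p0 \<in> V \<and>
       (let F = \<rho>1 \<circ> inv_into V \<phi>; G = \<rho>2 \<circ> inv_into V \<phi>; x = \<phi> p0 in
          F x = G x \<and>
          frechet_derivative F (at x) = frechet_derivative G (at x) \<and>
          (\<forall>v. frechet_derivative (\<lambda>y. frechet_derivative F (at y) v) (at x) =
               frechet_derivative (\<lambda>y. frechet_derivative G (at y) v) (at x)))"
      using assms(6) unfolding agree_to_second_order_def by (rule bexE)
    then show ?thesis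
      unfolding agree_to_second_order_def by (intro bexI[of _ V\<phi>]) (simp_all add: Let_def split: prod.splits)
  qed
  \<comment> \<open>Equal conditions give equal descriptions, so the two values of
    \<open>ddc\<close> agree.\<close>
  have "P \<rho>1 \<tau> = P \<rho>2 \<tau>" for \<tau>
  proof (rule ext, rule iffI)
    show "P \<rho>2 \<tau> c" if "P \<rho>1 \<tau> c" for c using imp[OF assms(5,4,6) that] .
    show "P \<rho>1 \<tau> c" if "P \<rho>2 \<tau> c" for c using imp[OF assms(4,5) sym that] .
  qed
  then have "ddc M T01 \<rho>1 p0 \<tau> = ddc M T01 \<rho>2 p0 \<tau>" for \<tau>
    unfolding ddc_def P_def fun_eq_iff by (simp only:)
  then show ?thesis by blast
qed

end
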